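(* Let $X$ be a real Banach space which is isomorphic to its hyperplanes, i.e. $X$ is linearly isomorphic to one (equivalently, to every) closed hyperplane of $X$. Then the Lipschitz-free spaces $\mathcal{F}(X)$ and $\mathcal{F}(S_X)$ are linearly isomorphic as Banach spaces, where $S_X=\{x\in X:\|x\|=1\}$ is the unit sphere of $X$ with the metric induced by the norm of $X$.
   Context: A closed hyperplane of $X$ is the kernel of a nonzero bounded linear functional on $X$. All closed hyperplanes of a given Banach space are isomorphic to each other. "Isomorphic" for Banach spaces means that there is a bounded linear bijection with bounded inverse (not necessarily isometric). Lipschitz-free space: for a metric space $M$ with a distinguished base point $0\in M$, $\mathrm{Lip}_0(M)$ is the Banach space of all real-valued Lipschitz functions $f$ on $M$ with $f(0)=0$, normed by the Lipschitz constant. For $x\in M$, let $\delta(x)\in \mathrm{Lip}_0(M)^*$ be the evaluation functional $\delta(x)(f)=f(x)$. The Lipschitz-free space $\mathcal{F}(M)$ is the norm-closed linear span of $\{\delta(x):x\in M\}$ in $\mathrm{Lip}_0(M)^*$. A different choice of base point gives an isometrically isomorphic space, so the base point of $S_X$ may be any of its points. *)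

theory Defs
  imports "HOL-Analysis.Analysis"
begin

text \<open>
  The spaces \<open>Lip\<^sub>0(M)\<close>, its dual and \<open>\<F>(M)\<close> depend on a set \<open>M\<close> and a base point, so they cannot be
  types of class \<^class>\<open>real_normed_vector\<close>.  They are represented by an explicit carrier together
  with the vector operations and the norm; everything outside the carrier is irrelevant.
\<close>

record 'v normed_space =
  vecs :: "'v set"
  vadd :: "'v \<Rightarrow> 'v \<Rightarrow> 'v"
  smul :: "real \<Rightarrow> 'v \<Rightarrow> 'v"
  vnorm :: "'v \<Rightarrow> real"

definition bounded_linear_map ::
    "'v normed_space \<Rightarrow> 'w normed_space \<Rightarrow> ('v \<Rightarrow> 'w) \<Rightarrow> bool" where
  "bounded_linear_map V W T \<longleftrightarrow>
     (\<forall>x\<in>vecs V. T x \<in> vecs W) \<and>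
     (\<forall>x\<in>vecs V. \<forall>y\<in>vecs V. T (vadd V x y) = vadd W (T x) (T y)) \<and>
     (\<forall>c. \<forall>x\<in>vecs V. T (smul V c x) = smul W c (T x)) \<and>
     (\<exists>B. \<forall>x\<in>vecs V. vnorm W (T x) \<le> B * vnorm V x)"

definition isomorphic :: "'v normed_space \<Rightarrow> 'w normed_space \<Rightarrow> bool" where
  "isomorphic V W \<longleftrightarrow>
     (\<exists>T. bij_betw T (vecs V) (vecs W) \<and>
          bounded_linear_map V W T \<and>
          bounded_linear_map W V (inv_into (vecs V) T))"

definition subspace_of_type :: "'a::real_normed_vector set \<Rightarrow> 'a normed_space" where
  "subspace_of_type U = \<lparr>vecs = U, vadd = (+), smul = (*\<^sub>R), vnorm = norm\<rparr>"

definition closed_hyperplane :: "'a::real_normed_vector set \<Rightarrow> bool" where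
  "closed_hyperplane H \<longleftrightarrow>
     (\<exists>h::'a \<Rightarrow> real. bounded_linear h \<and> (\<exists>x. h x \<noteq> 0) \<and> H = {x. h x = 0})"

definition real_line :: "real normed_space" where
  "real_line = subspace_of_type UNIV"

text \<open>
  Functionals are set to 0 off the carrier of \<open>V\<close>, so that distinct elements of the dual are
  distinct functionals on \<open>V\<close>.
\<close>

definition dual_space :: "'v normed_space \<Rightarrow> ('v \<Rightarrow> real) normed_space" where
  "dual_space V =
     \<lparr>vecs = {\<phi>. bounded_linear_map V real_line \<phi> \<and> (\<forall>x. x \<notin> vecs V \<longrightarrow> \<phi> x = 0)},
      vadd = (\<lambda>\<phi> \<psi> x. \<phi> x + \<psi> x),
      smul = (\<lambda>c \<phi> x. c * \<phi> x),
      vnorm = (\<lambda>\<phi>. SUP x\<in>{x\<in>vecs V. vnorm V x \<le> 1}. \<bar>\<phi> x\<bar>)\<rparr>"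

text \<open>
  Likewise, a function on \<open>M\<close> is represented by its extension by 0.  The Lipschitz constant is the
  least \<open>C\<close> with \<open>C\<close>-\<open>lipschitz_on M f\<close>; this is 0 when \<open>M\<close> is a singleton.
\<close>

definition Lip0 :: "'a::metric_space set \<Rightarrow> 'a \<Rightarrow> ('a \<Rightarrow> real) normed_space" where
  "Lip0 M p =
     \<lparr>vecs = {f. (\<exists>C. C-lipschitz_on M f) \<and> f p = 0 \<and> (\<forall>x. x \<notin> M \<longrightarrow> f x = 0)},
      vadd = (\<lambda>f g x. f x + g x),
      smul = (\<lambda>c f x. c * f x),
      vnorm = (\<lambda>f. Inf {C. C-lipschitz_on M f})\<rparr>"

definition evaluation :: "'a::metric_space set \<Rightarrow> 'a \<Rightarrow> 'a \<Rightarrow> ('a \<Rightarrow> real) \<Rightarrow> real" where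
  "evaluation M p x = (\<lambda>f. if f \<in> vecs (Lip0 M p) then f x else 0)"

definition evaluation_span :: "'a::metric_space set \<Rightarrow> 'a \<Rightarrow> (('a \<Rightarrow> real) \<Rightarrow> real) set" where
  "evaluation_span M p =
     {(\<lambda>f. \<Sum>x\<in>A. c x * evaluation M p x f) | A c. finite A \<and> A \<subseteq> M}"

definition lipschitz_free ::
    "'a::metric_space set \<Rightarrow> 'a \<Rightarrow> (('a \<Rightarrow> real) \<Rightarrow> real) normed_space" where
  "lipschitz_free M p =
     (let D = dual_space (Lip0 M p) in
      D\<lparr>vecs := {\<phi>\<in>vecs D. \<forall>e>0. \<exists>\<psi>\<in>evaluation_span M p. vnorm D (\<lambda>f. \<phi> f - \<psi> f) < e}\<rparr>)"

end

theory Submission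
  imports Defs
begin

text \<open>
  Operators between spaces \<open>Lip\<^sub>0\<close> that are bounded and evaluate, at each point, to a finite
  combination of point values are adjoints of operators between the free spaces; so it suffices to
  find mutually inverse operators of this kind.  Let \<open>H = ker h\<close> with \<open>h e = \<parallel>e\<parallel> = 1\<close>.

  A stereographic map \<open>x \<mapsto> w(x) / \<parallel>w(x)\<parallel>\<close> identifies \<open>H\<close> with the sphere punctured at \<open>e\<close> and
  distorts distances near \<open>x\<close> by a factor of order \<open>(1 + \<parallel>x\<parallel>)\<^sup>-\<^sup>2\<close>.  The weighted composition
  \<open>f \<mapsto> \<parallel>w(x)\<parallel> f(w(x) / \<parallel>w(x)\<parallel>)\<close> compensates for this distortion: it is an isomorphism from the
  Lipschitz functions on the sphere vanishing at \<open>e\<close> onto all Lipschitz functions on \<open>H\<close>, that is,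
  onto \<open>Lip\<^sub>0(H \<union> {e})\<close> with base point \<open>e\<close>.  The additional value at \<open>0\<close> is absorbed by a shift along
  the points \<open>0, v, 2v, \<dots>\<close> of a ray in \<open>H\<close>, which gives \<open>\<F>(S) \<simeq> \<F>(H \<union> {e}) \<simeq> \<F>(H) \<simeq> \<F>(X)\<close>.
\<close>

subsection \<open>Isomorphisms of normed spaces given by carriers\<close>

text \<open>
  \<^const>\<open>isomorphic\<close> does not ask its arguments to be vector spaces.  Without closure under the
  operations the inverse of a linear bijection need not be linear.
\<close>

definition normed_subspace :: "'v normed_space \<Rightarrow> bool" where
  "normed_subspace V \<longleftrightarrow>
     (\<forall>x\<in>vecs V. \<forall>y\<in>vecs V. vadd V x y \<in> vecs V) \<and>
     (\<forall>c. \<forall>x\<in>vecs V. smul V c x \<in> vecs V) \<and>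
     (\<forall>x\<in>vecs V. vnorm V x \<ge> 0)"

lemma isomorphicI:
  assumes W: "normed_subspace W"
    and T: "bounded_linear_map V W T" and U: "bounded_linear_map W V U"
    and UT: "\<And>x. x \<in> vecs V \<Longrightarrow> U (T x) = x"
    and TU: "\<And>y. y \<in> vecs W \<Longrightarrow> T (U y) = y"
  shows "isomorphic V W"
proof -
  have mem: "\<And>x. x \<in> vecs V \<Longrightarrow> T x \<in> vecs W" "\<And>y. y \<in> vecs W \<Longrightarrow> U y \<in> vecs V"
    using T U by (auto simp: bounded_linear_map_def)
  have bij: "bij_betw T (vecs V) (vecs W)"
    using mem UT TU by (intro bij_betw_byWitness[where f' = U]) auto
  have inv: "inv_into (vecs V) T y = U y" if "y \<in> vecs W" for y
    using bij_betw_inv_into_left[OF bij, of "U y"] mem(2)[OF that] TU[OF that] by simp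
  have "bounded_linear_map W V (inv_into (vecs V) T)"
    using U W inv unfolding bounded_linear_map_def normed_subspace_def by simp
  then show ?thesis
    using bij T by (auto simp: isomorphic_def)
qed

lemma isomorphicE:
  assumes "isomorphic V W"
  obtains T U where "bounded_linear_map V W T" "bounded_linear_map W V U"
    "\<And>x. x \<in> vecs V \<Longrightarrow> U (T x) = x" "\<And>y. y \<in> vecs W \<Longrightarrow> T (U y) = y"
proof -
  obtain T where T: "bij_betw T (vecs V) (vecs W)" "bounded_linear_map V W T"
    "bounded_linear_map W V (inv_into (vecs V) T)"
    using assms by (auto simp: isomorphic_def)
  show ?thesis
    using T by (intro that[of T "inv_into (vecs V) T"])
      (auto simp: bij_betw_inv_into_left bij_betw_inv_into_right)
qed

text \<open>In an arbitrary record \<open>vnorm\<close> may be negative, and so may the constant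
  \<open>B\<close>; absolute values on both make the bound usable in monotonicity arguments.\<close>

lemma bounded_linear_map_bound:
  assumes "bounded_linear_map V W T"
  obtains B where "B \<ge> 0" "\<And>x. x \<in> vecs V \<Longrightarrow> vnorm W (T x) \<le> B * \<bar>vnorm V x\<bar>"
proof -
  obtain B where B: "\<And>x. x \<in> vecs V \<Longrightarrow> vnorm W (T x) \<le> B * vnorm V x"
    using assms unfolding bounded_linear_map_def by blast
  show ?thesis
  proof (rule that[of "\<bar>B\<bar>"])
    fix x assume "x \<in> vecs V"
    then show "vnorm W (T x) \<le> \<bar>B\<bar> * \<bar>vnorm V x\<bar>"
      using B[of x] by (simp flip: abs_mult)
  qed simp
qed

lemma isomorphic_sym: "isomorphic V W \<Longrightarrow> normed_subspace V \<Longrightarrow> isomorphic W V"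
  by (erule isomorphicE) (rule isomorphicI)

lemma bounded_linear_map_compose:
  assumes T: "bounded_linear_map V W T" and U: "bounded_linear_map W Z U"
    and "normed_subspace V" "normed_subspace W"
  shows "bounded_linear_map V Z (\<lambda>x. U (T x))"
proof -
  have nonneg: "\<And>x. x \<in> vecs W \<Longrightarrow> vnorm W x \<ge> 0" "\<And>x. x \<in> vecs V \<Longrightarrow> vnorm V x \<ge> 0"
    using assms(3,4) by (auto simp: normed_subspace_def)
  obtain B where B: "B \<ge> 0" "\<And>x. x \<in> vecs V \<Longrightarrow> vnorm W (T x) \<le> B * \<bar>vnorm V x\<bar>"
    using bounded_linear_map_bound[OF T] by blast
  obtain C where C: "C \<ge> 0" "\<And>x. x \<in> vecs W \<Longrightarrow> vnorm Z (U x) \<le> C * \<bar>vnorm W x\<bar>"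
    using bounded_linear_map_bound[OF U] by blast
  have mem: "\<And>x. x \<in> vecs V \<Longrightarrow> T x \<in> vecs W"
    using T by (auto simp: bounded_linear_map_def)
  have "vnorm Z (U (T x)) \<le> C * B * vnorm V x" if "x \<in> vecs V" for x
  proof -
    have "vnorm Z (U (T x)) \<le> C * vnorm W (T x)"
      using C(2)[of "T x"] mem[OF that] nonneg by simp
    also have "\<dots> \<le> C * (B * vnorm V x)"
      using B(2)[OF that] nonneg(2)[OF that] C(1) by (intro mult_left_mono) auto
    finally show ?thesis by (simp add: mult.assoc)
  qed
  then show ?thesis
    using T U unfolding bounded_linear_map_def by auto
qed

lemma isomorphic_trans:
  assumes "isomorphic V W" "isomorphic W Z"
    and "normed_subspace V" "normed_subspace W" "normed_subspace Z"
  shows "isomorphic V Z"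
proof -
  obtain T U where TU: "bounded_linear_map V W T" "bounded_linear_map W V U"
    "\<And>x. x \<in> vecs V \<Longrightarrow> U (T x) = x" "\<And>y. y \<in> vecs W \<Longrightarrow> T (U y) = y"
    using isomorphicE[OF assms(1)] by blast
  obtain T' U' where TU': "bounded_linear_map W Z T'" "bounded_linear_map Z W U'"
    "\<And>x. x \<in> vecs W \<Longrightarrow> U' (T' x) = x" "\<And>y. y \<in> vecs Z \<Longrightarrow> T' (U' y) = y"
    using isomorphicE[OF assms(2)] by blast
  have mem: "\<And>x. x \<in> vecs V \<Longrightarrow> T x \<in> vecs W" "\<And>x. x \<in> vecs Z \<Longrightarrow> U' x \<in> vecs W"
    using TU TU' by (auto simp: bounded_linear_map_def)
  show ?thesis
  proof (rule isomorphicI)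
    show "bounded_linear_map V Z (\<lambda>x. T' (T x))"
      using TU(1) TU'(1) assms(3,4) by (rule bounded_linear_map_compose)
    show "bounded_linear_map Z V (\<lambda>x. U (U' x))"
      using TU'(2) TU(2) assms(5,4) by (rule bounded_linear_map_compose)
  qed (use TU TU' mem assms(5) in auto)
qed

subsection \<open>Lipschitz-free spaces and their adjoint operators\<close>

lemma Lip0_mem:
  "f \<in> vecs (Lip0 M p) \<longleftrightarrow> (\<exists>C. C-lipschitz_on M f) \<and> f p = 0 \<and> (\<forall>x. x \<notin> M \<longrightarrow> f x = 0)"
  by (auto simp: Lip0_def)

lemma Lip0_simps [simp]:
  "vadd (Lip0 M p) = (\<lambda>f g x. f x + g x)"
  "smul (Lip0 M p) = (\<lambda>c f x. c * f x)"
  by (auto simp: Lip0_def)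

lemma Lip0_norm_le: "C-lipschitz_on M f \<Longrightarrow> vnorm (Lip0 M p) f \<le> C"
  by (auto simp: Lip0_def intro!: cInf_lower bdd_belowI[where m = 0] dest: lipschitz_on_nonneg)

text \<open>For distinct \<open>x\<close> and \<open>y\<close> every admissible constant dominates
  the quotient of the two distances, hence so does the infimum of these constants.\<close>

lemma Lip0_norm_attained:
  assumes "f \<in> vecs (Lip0 M p)"
  shows "(vnorm (Lip0 M p) f)-lipschitz_on M f"
proof -
  obtain C where C: "C-lipschitz_on M f" using assms by (auto simp: Lip0_mem)
  let ?I = "Inf {C. C-lipschitz_on M f}"
  have "?I \<ge> 0"
    using C by (intro cInf_greatest) (auto dest: lipschitz_on_nonneg)
  moreover have "dist (f x) (f y) \<le> ?I * dist x y" if "x \<in> M" "y \<in> M" for x y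
  proof (cases "x = y")
    case False
    have "dist (f x) (f y) / dist x y \<le> ?I"
      using C False that by (intro cInf_greatest)
        (auto simp: divide_le_eq dest: lipschitz_onD)
    then show ?thesis using False by (simp add: divide_le_eq)
  qed simp
  ultimately show ?thesis
    by (auto simp: Lip0_def intro: lipschitz_onI)
qed

lemma Lip0_smul_mem: "f \<in> vecs (Lip0 M p) \<Longrightarrow> (\<lambda>x. c * f x) \<in> vecs (Lip0 M p)"
  using lipschitz_on_cmult_real by (fastforce simp: Lip0_mem)

lemma Lip0_add_mem:
  "f \<in> vecs (Lip0 M p) \<Longrightarrow> g \<in> vecs (Lip0 M p) \<Longrightarrow> (\<lambda>x. f x + g x) \<in> vecs (Lip0 M p)"
  using lipschitz_on_add by (fastforce simp: Lip0_mem)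

text \<open>Trades the operator bound in terms of the norm, an infimum, for one in terms of any
  Lipschitz constant of \<open>f\<close>. Both say the same because the norm is itself the least
  Lipschitz constant.\<close>

lemma dual_Lip0_iff:
  "\<phi> \<in> vecs (dual_space (Lip0 M p)) \<longleftrightarrow>
     (\<forall>f\<in>vecs (Lip0 M p). \<forall>g\<in>vecs (Lip0 M p). \<phi> (\<lambda>x. f x + g x) = \<phi> f + \<phi> g) \<and>
     (\<forall>c. \<forall>f\<in>vecs (Lip0 M p). \<phi> (\<lambda>x. c * f x) = c * \<phi> f) \<and>
     (\<exists>B. \<forall>C f. f \<in> vecs (Lip0 M p) \<and> C-lipschitz_on M f \<longrightarrow> \<bar>\<phi> f\<bar> \<le> B * C) \<and>
     (\<forall>f. f \<notin> vecs (Lip0 M p) \<longrightarrow> \<phi> f = 0)"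
  (is "?l \<longleftrightarrow> ?r")
proof -
  have "(\<exists>B. \<forall>f\<in>vecs (Lip0 M p). \<bar>\<phi> f\<bar> \<le> B * vnorm (Lip0 M p) f) \<longleftrightarrow>
    (\<exists>B. \<forall>C f. f \<in> vecs (Lip0 M p) \<and> C-lipschitz_on M f \<longrightarrow> \<bar>\<phi> f\<bar> \<le> B * C)"
    (is "(\<exists>B. ?P B) \<longleftrightarrow> (\<exists>B. ?Q B)")
  proof
    assume "\<exists>B. ?P B"
    then obtain B where B: "?P B" by blast
    have "\<bar>\<phi> f\<bar> \<le> \<bar>B\<bar> * C" if "f \<in> vecs (Lip0 M p)" "C-lipschitz_on M f" for C f
    proof -
      have "\<bar>\<phi> f\<bar> \<le> B * vnorm (Lip0 M p) f" using B that(1) by blast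
      also have "\<dots> \<le> \<bar>B\<bar> * vnorm (Lip0 M p) f"
        using lipschitz_on_nonneg[OF Lip0_norm_attained[OF that(1)]] by (intro mult_right_mono) auto
      also have "\<dots> \<le> \<bar>B\<bar> * C"
        using Lip0_norm_le[OF that(2)] by (intro mult_left_mono) auto
      finally show ?thesis .
    qed
    then show "\<exists>B. ?Q B" by blast
  next
    assume "\<exists>B. ?Q B"
    then show "\<exists>B. ?P B" using Lip0_norm_attained by metis
  qed
  then show ?thesis
    unfolding dual_space_def bounded_linear_map_def real_line_def subspace_of_type_def
    by auto
qed

lemma dual_Lip0_linear:
  assumes "\<phi> \<in> vecs (dual_space (Lip0 M p))" "f \<in> vecs (Lip0 M p)"
  shows "g \<in> vecs (Lip0 M p) \<Longrightarrow> \<phi> (\<lambda>x. f x + g x) = \<phi> f + \<phi> g"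
    and "\<phi> (\<lambda>x. c * f x) = c * \<phi> f"
  using assms unfolding dual_Lip0_iff by blast+

lemma dual_Lip0_simps [simp]:
  "vadd (dual_space V) = (\<lambda>\<phi> \<psi> x. \<phi> x + \<psi> x)"
  "smul (dual_space V) = (\<lambda>c \<phi> x. c * \<phi> x)"
  by (auto simp: dual_space_def)

text \<open>Scaling by \<open>1 / C\<close> puts \<open>f\<close> into the unit ball. Membership of
  \<open>\<phi>\<close> in the dual bounds the set under the supremum, so that the supremum
  dominates its terms.\<close>

lemma dual_norm_bound:
  assumes \<phi>: "\<phi> \<in> vecs (dual_space (Lip0 M p))" and f: "f \<in> vecs (Lip0 M p)"
    and C: "C-lipschitz_on M f" "C > 0"
  shows "\<bar>\<phi> f\<bar> \<le> C * vnorm (dual_space (Lip0 M p)) \<phi>"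
proof -
  obtain B where B: "\<And>C f. f \<in> vecs (Lip0 M p) \<Longrightarrow> C-lipschitz_on M f \<Longrightarrow> \<bar>\<phi> f\<bar> \<le> B * C"
    using \<phi> unfolding dual_Lip0_iff by blast
  let ?U = "{f \<in> vecs (Lip0 M p). vnorm (Lip0 M p) f \<le> 1}"
  have bdd: "bdd_above ((\<lambda>f. \<bar>\<phi> f\<bar>) ` ?U)"
  proof (rule bdd_aboveI2)
    fix f assume f: "f \<in> ?U"
    then have "1-lipschitz_on M f"
      using Lip0_norm_attained lipschitz_on_le by blast
    then show "\<bar>\<phi> f\<bar> \<le> B" using B[of f 1] f by simp
  qed
  let ?g = "\<lambda>x. (1 / C) * f x"
  have "(\<bar>1 / C\<bar> * C)-lipschitz_on M ?g"
    using C by (intro lipschitz_on_cmult_real)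
  then have "vnorm (Lip0 M p) ?g \<le> 1"
    using C(2) Lip0_norm_le[of 1 M ?g p] by simp
  then have "?g \<in> ?U" using Lip0_smul_mem[OF f] by blast
  then have "\<bar>\<phi> ?g\<bar> \<le> vnorm (dual_space (Lip0 M p)) \<phi>"
    unfolding dual_space_def using bdd by (auto intro!: cSUP_upper)
  moreover have "\<phi> ?g = (1 / C) * \<phi> f"
    using \<phi> f unfolding dual_Lip0_iff by blast
  ultimately have "\<bar>(1 / C) * \<phi> f\<bar> \<le> vnorm (dual_space (Lip0 M p)) \<phi>"
    by simp
  then show ?thesis using C(2) by (simp add: abs_mult field_simps)
qed

lemma zero_in_Lip0: "(\<lambda>x. 0) \<in> vecs (Lip0 M p)"
  by (auto simp: Lip0_mem intro!: exI[of _ 0] lipschitz_onI)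

lemma dual_norm_le:
  assumes "\<And>f. f \<in> vecs (Lip0 M p) \<Longrightarrow> 1-lipschitz_on M f \<Longrightarrow> \<bar>\<phi> f\<bar> \<le> B"
  shows "vnorm (dual_space (Lip0 M p)) \<phi> \<le> B"
proof -
  have "1-lipschitz_on M f" if "f \<in> vecs (Lip0 M p)" "vnorm (Lip0 M p) f \<le> 1" for f
    using Lip0_norm_attained lipschitz_on_le that by blast
  \<comment> \<open>The zero function makes the unit ball nonempty, as the least upper bound
    property of the supremum requires.\<close>
  moreover have "vnorm (Lip0 M p) (\<lambda>x. 0) \<le> 1"
    by (intro Lip0_norm_le lipschitz_onI) auto
  ultimately show ?thesis
    unfolding dual_space_def using assms zero_in_Lip0[of M p]
    by (auto intro!: cSUP_least)
qed

lemma dual_norm_nonneg: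
  assumes "\<phi> \<in> vecs (dual_space (Lip0 M p))"
  shows "vnorm (dual_space (Lip0 M p)) \<phi> \<ge> 0"
proof -
  have "1-lipschitz_on M (\<lambda>x. 0 :: real)"
    by (rule lipschitz_onI) auto
  then show ?thesis
    using dual_norm_bound[OF assms zero_in_Lip0, of 1] by simp
qed

lemma lipschitz_free_simps [simp]:
  "vadd (lipschitz_free M p) = (\<lambda>\<phi> \<psi> x. \<phi> x + \<psi> x)"
  "smul (lipschitz_free M p) = (\<lambda>c \<phi> x. c * \<phi> x)"
  "vnorm (lipschitz_free M p) = vnorm (dual_space (Lip0 M p))"
  by (auto simp: lipschitz_free_def Let_def)

lemma lipschitz_free_mem:
  "\<phi> \<in> vecs (lipschitz_free M p) \<longleftrightarrow> \<phi> \<in> vecs (dual_space (Lip0 M p)) \<and>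
     (\<forall>e>0. \<exists>\<psi>\<in>evaluation_span M p. vnorm (dual_space (Lip0 M p)) (\<lambda>f. \<phi> f - \<psi> f) < e)"
  by (auto simp: lipschitz_free_def Let_def)

section \<open>Finite combinations of point values\<close>

text \<open>Unlike the elements of \<open>evaluation_span\<close>, these functionals live on all
  functions, with neither a Lipschitz condition nor a base point. Hence they are linear without side
  conditions and see only the values on \<open>M\<close>.\<close>

definition finite_combination :: "'a set \<Rightarrow> (('a \<Rightarrow> real) \<Rightarrow> real) \<Rightarrow> bool" where
  "finite_combination M \<phi> \<longleftrightarrow>
     (\<exists>A c. finite A \<and> A \<subseteq> M \<and> (\<forall>f. \<phi> f = (\<Sum>x\<in>A. c x * f x)))"

lemma finite_combination_point: "x \<in> M \<Longrightarrow> finite_combination M (\<lambda>f. f x)"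
  unfolding finite_combination_def
  by (intro exI[of _ "{x}"] exI[of _ "\<lambda>_. 1"]) auto

lemma finite_combination_zero: "finite_combination M (\<lambda>f. 0)"
  unfolding finite_combination_def by (intro exI[of _ "{}"]) auto

lemma finite_combination_cmult:
  assumes "finite_combination M \<phi>"
  shows "finite_combination M (\<lambda>f. k * \<phi> f)"
proof -
  obtain A c where "finite A" "A \<subseteq> M" "\<And>f. \<phi> f = (\<Sum>x\<in>A. c x * f x)"
    using assms by (auto simp: finite_combination_def)
  then show ?thesis
    unfolding finite_combination_def
    by (intro exI[of _ A] exI[of _ "\<lambda>x. k * c x"]) (auto simp: sum_distrib_left mult.assoc)
qed

lemma finite_combination_add:
  assumes "finite_combination M \<phi>" "finite_combination M \<psi>"
  shows "finite_combination M (\<lambda>f. \<phi> f + \<psi> f)"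
proof -
  obtain A c where A: "finite A" "A \<subseteq> M" "\<And>f. \<phi> f = (\<Sum>x\<in>A. c x * f x)"
    using assms(1) by (auto simp: finite_combination_def)
  obtain B d where B: "finite B" "B \<subseteq> M" "\<And>f. \<psi> f = (\<Sum>x\<in>B. d x * f x)"
    using assms(2) by (auto simp: finite_combination_def)
  \<comment> \<open>Both coefficient families are extended by 0 to the union; they add up on the
    overlap.\<close>
  let ?c = "\<lambda>x. (if x \<in> A then c x else 0) + (if x \<in> B then d x else 0)"
  have "\<phi> f + \<psi> f = (\<Sum>x\<in>A \<union> B. ?c x * f x)" for f
  proof -
    have "(\<Sum>x\<in>A. c x * f x) = (\<Sum>x\<in>A \<union> B. (if x \<in> A then c x else 0) * f x)"
      using A B by (intro sum.mono_neutral_cong_left) auto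
    moreover have "(\<Sum>x\<in>B. d x * f x) = (\<Sum>x\<in>A \<union> B. (if x \<in> B then d x else 0) * f x)"
      using A B by (intro sum.mono_neutral_cong_left) auto
    ultimately show ?thesis using A B by (simp add: sum.distrib distrib_right)
  qed
  then show ?thesis
    unfolding finite_combination_def using A B
    by (intro exI[of _ "A \<union> B"] exI[of _ ?c]) auto
qed

lemma finite_combination_diff:
  "finite_combination M \<phi> \<Longrightarrow> finite_combination M \<psi> \<Longrightarrow> finite_combination M (\<lambda>f. \<phi> f - \<psi> f)"
  using finite_combination_add[OF _ finite_combination_cmult[of M \<psi> "-1"]] by simp

lemma finite_combination_sum:
  "finite I \<Longrightarrow> (\<And>i. i \<in> I \<Longrightarrow> finite_combination M (\<phi> i)) \<Longrightarrow>
    finite_combination M (\<lambda>f. \<Sum>i\<in>I. \<phi> i f)"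
  by (induction I rule: finite_induct)
    (auto intro: finite_combination_add finite_combination_zero)

lemmas finite_combination_intros = finite_combination_point finite_combination_zero
  finite_combination_cmult finite_combination_add finite_combination_diff

lemma finite_combination_linear:
  assumes "finite_combination M \<phi>"
  shows "\<phi> (\<lambda>x. f x + g x) = \<phi> f + \<phi> g" "\<phi> (\<lambda>x. c * f x) = c * \<phi> f"
  using assms
  by (auto simp: finite_combination_def distrib_left sum.distrib sum_distrib_left mult.left_commute)

lemma finite_combination_cong:
  assumes "finite_combination M \<phi>" "\<And>x. x \<in> M \<Longrightarrow> f x = g x"
  shows "\<phi> f = \<phi> g"
  using assms by (fastforce simp: finite_combination_def intro!: sum.cong)

lemma evaluation_span_iff:
  "\<psi> \<in> evaluation_span M p \<longleftrightarrow>
    (\<exists>\<phi>. finite_combination M \<phi> \<and> \<psi> = (\<lambda>f. if f \<in> vecs (Lip0 M p) then \<phi> f else 0))"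
proof
  assume "\<psi> \<in> evaluation_span M p"
  then obtain A c where "finite A" "A \<subseteq> M" "\<psi> = (\<lambda>f. \<Sum>x\<in>A. c x * evaluation M p x f)"
    by (auto simp: evaluation_span_def)
  then show "\<exists>\<phi>. finite_combination M \<phi> \<and> \<psi> = (\<lambda>f. if f \<in> vecs (Lip0 M p) then \<phi> f else 0)"
    by (intro exI[of _ "\<lambda>f. \<Sum>x\<in>A. c x * f x"])
      (auto simp: evaluation_def finite_combination_def fun_eq_iff)
next
  assume "\<exists>\<phi>. finite_combination M \<phi> \<and> \<psi> = (\<lambda>f. if f \<in> vecs (Lip0 M p) then \<phi> f else 0)"
  then obtain \<phi> A c where "finite A" "A \<subseteq> M" "\<And>f. \<phi> f = (\<Sum>x\<in>A. c x * f x)"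
    "\<psi> = (\<lambda>f. if f \<in> vecs (Lip0 M p) then \<phi> f else 0)"
    unfolding finite_combination_def by blast
  moreover from this have "\<psi> = (\<lambda>f. \<Sum>x\<in>A. c x * evaluation M p x f)"
    by (auto simp: evaluation_def fun_eq_iff)
  ultimately show "\<psi> \<in> evaluation_span M p"
    unfolding evaluation_span_def by blast
qed

text \<open>A \<open>C\<close>-Lipschitz \<open>f\<close> with \<open>f p = 0\<close> satisfies
  \<open>\<bar>f x\<bar> \<le> C * dist x p\<close> on \<open>M\<close>, so point values are bounded
  functionals.\<close>

lemma evaluation_span_subset_dual:
  assumes "p \<in> M"
  shows "evaluation_span M p \<subseteq> vecs (dual_space (Lip0 M p))"
proof
  fix \<psi> assume "\<psi> \<in> evaluation_span M p"
  then obtain \<phi> where \<phi>: "finite_combination M \<phi>"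
    and \<psi>: "\<psi> = (\<lambda>f. if f \<in> vecs (Lip0 M p) then \<phi> f else 0)"
    by (auto simp: evaluation_span_iff)
  obtain A c where A: "A \<subseteq> M" "\<And>f. \<phi> f = (\<Sum>x\<in>A. c x * f x)"
    using \<phi> by (auto simp: finite_combination_def)
  have "\<bar>\<phi> f\<bar> \<le> (\<Sum>x\<in>A. \<bar>c x\<bar> * dist x p) * C"
    if "f \<in> vecs (Lip0 M p)" "C-lipschitz_on M f" for C f
  proof -
    have "\<bar>\<phi> f\<bar> \<le> (\<Sum>x\<in>A. \<bar>c x * f x\<bar>)"
      by (simp add: A)
    also have "\<dots> \<le> (\<Sum>x\<in>A. \<bar>c x\<bar> * dist x p * C)"
    proof (rule sum_mono)
      fix x assume "x \<in> A"
      then have "\<bar>f x\<bar> \<le> dist x p * C"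
        using lipschitz_onD[OF that(2), of x p] that(1) A assms
        by (auto simp: Lip0_mem dist_real_def mult.commute)
      then show "\<bar>c x * f x\<bar> \<le> \<bar>c x\<bar> * dist x p * C"
        by (simp add: abs_mult mult_left_mono mult.assoc)
    qed
    finally show ?thesis by (simp add: sum_distrib_right)
  qed
  then show "\<psi> \<in> vecs (dual_space (Lip0 M p))"
    unfolding dual_Lip0_iff \<psi>
    using finite_combination_linear[OF \<phi>] Lip0_add_mem[of _ M p] Lip0_smul_mem[of _ M p]
    by simp blast
qed

lemma dual_Lip0_add_mem:
  assumes "\<phi> \<in> vecs (dual_space (Lip0 M p))" "\<psi> \<in> vecs (dual_space (Lip0 M p))"
  shows "(\<lambda>f. \<phi> f + \<psi> f) \<in> vecs (dual_space (Lip0 M p))"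
proof -
  obtain B where "\<And>C f. f \<in> vecs (Lip0 M p) \<Longrightarrow> C-lipschitz_on M f \<Longrightarrow> \<bar>\<phi> f\<bar> \<le> B * C"
    using assms(1) unfolding dual_Lip0_iff by blast
  moreover obtain B' where
    "\<And>C f. f \<in> vecs (Lip0 M p) \<Longrightarrow> C-lipschitz_on M f \<Longrightarrow> \<bar>\<psi> f\<bar> \<le> B' * C"
    using assms(2) unfolding dual_Lip0_iff by blast
  ultimately have "\<bar>\<phi> f + \<psi> f\<bar> \<le> (B + B') * C"
    if "f \<in> vecs (Lip0 M p)" "C-lipschitz_on M f" for C f
    using that by (smt (verit) distrib_right)
  then have "\<exists>B. \<forall>C f. f \<in> vecs (Lip0 M p) \<and> C-lipschitz_on M f \<longrightarrow> \<bar>\<phi> f + \<psi> f\<bar> \<le> B * C"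
    by blast
  then show ?thesis
    using assms unfolding dual_Lip0_iff by (simp add: distrib_left)
qed

lemma dual_Lip0_cmult_mem:
  assumes "\<phi> \<in> vecs (dual_space (Lip0 M p))"
  shows "(\<lambda>f. c * \<phi> f) \<in> vecs (dual_space (Lip0 M p))"
proof -
  obtain B where B: "\<And>C f. f \<in> vecs (Lip0 M p) \<Longrightarrow> C-lipschitz_on M f \<Longrightarrow> \<bar>\<phi> f\<bar> \<le> B * C"
    using assms unfolding dual_Lip0_iff by blast
  have "\<bar>c * \<phi> f\<bar> \<le> (\<bar>c\<bar> * B) * C" if "f \<in> vecs (Lip0 M p)" "C-lipschitz_on M f" for C f
    using B[OF that] by (simp add: abs_mult mult.assoc mult_left_mono)
  then have "\<exists>B. \<forall>C f. f \<in> vecs (Lip0 M p) \<and> C-lipschitz_on M f \<longrightarrow> \<bar>c * \<phi> f\<bar> \<le> B * C"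
    by blast
  then show ?thesis
    using assms unfolding dual_Lip0_iff by (simp add: distrib_left mult.left_commute)
qed

lemma dual_Lip0_diff_mem:
  "\<phi> \<in> vecs (dual_space (Lip0 M p)) \<Longrightarrow> \<psi> \<in> vecs (dual_space (Lip0 M p)) \<Longrightarrow>
    (\<lambda>f. \<phi> f - \<psi> f) \<in> vecs (dual_space (Lip0 M p))"
  using dual_Lip0_add_mem[OF _ dual_Lip0_cmult_mem[of \<psi> M p "-1"]] by simp

lemma evaluation_span_add:
  assumes "\<psi> \<in> evaluation_span M p" "\<psi>' \<in> evaluation_span M p"
  shows "(\<lambda>f. \<psi> f + \<psi>' f) \<in> evaluation_span M p"
proof -
  obtain \<phi> \<phi>' where "finite_combination M \<phi>" "finite_combination M \<phi>'"
    "\<psi> = (\<lambda>f. if f \<in> vecs (Lip0 M p) then \<phi> f else 0)"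
    "\<psi>' = (\<lambda>f. if f \<in> vecs (Lip0 M p) then \<phi>' f else 0)"
    using assms unfolding evaluation_span_iff by blast
  then show ?thesis
    unfolding evaluation_span_iff
    by (intro exI[of _ "\<lambda>f. \<phi> f + \<phi>' f"]) (auto intro: finite_combination_add)
qed

lemma evaluation_span_cmult:
  assumes "\<psi> \<in> evaluation_span M p"
  shows "(\<lambda>f. c * \<psi> f) \<in> evaluation_span M p"
proof -
  obtain \<phi> where "finite_combination M \<phi>" "\<psi> = (\<lambda>f. if f \<in> vecs (Lip0 M p) then \<phi> f else 0)"
    using assms unfolding evaluation_span_iff by blast
  then show ?thesis
    unfolding evaluation_span_iff
    by (intro exI[of _ "\<lambda>f. c * \<phi> f"]) (auto intro: finite_combination_cmult)
qed

lemma normed_subspace_lipschitz_free: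
  assumes p: "p \<in> M"
  shows "normed_subspace (lipschitz_free M p)"
proof -
  let ?D = "dual_space (Lip0 M p)"
  have span: "\<And>\<psi>. \<psi> \<in> evaluation_span M p \<Longrightarrow> \<psi> \<in> vecs ?D"
    using evaluation_span_subset_dual[OF p] by blast
  have "(\<lambda>f. \<phi> f + \<phi>' f) \<in> vecs (lipschitz_free M p)"
    if \<phi>: "\<phi> \<in> vecs (lipschitz_free M p)" "\<phi>' \<in> vecs (lipschitz_free M p)" for \<phi> \<phi>'
  proof -
    have dual: "\<phi> \<in> vecs ?D" "\<phi>' \<in> vecs ?D"
      using \<phi> by (auto simp: lipschitz_free_mem)
    have "\<exists>\<psi>\<in>evaluation_span M p. vnorm ?D (\<lambda>f. \<phi> f + \<phi>' f - \<psi> f) < e" if "e > 0" for e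
    proof -
      obtain \<psi> where \<psi>: "\<psi> \<in> evaluation_span M p" "vnorm ?D (\<lambda>f. \<phi> f - \<psi> f) < e / 2"
        using \<phi>(1) half_gt_zero[OF \<open>e > 0\<close>] unfolding lipschitz_free_mem by blast
      obtain \<psi>' where \<psi>': "\<psi>' \<in> evaluation_span M p" "vnorm ?D (\<lambda>f. \<phi>' f - \<psi>' f) < e / 2"
        using \<phi>(2) half_gt_zero[OF \<open>e > 0\<close>] unfolding lipschitz_free_mem by blast
      have "vnorm ?D (\<lambda>f. \<phi> f + \<phi>' f - (\<psi> f + \<psi>' f)) \<le>
          vnorm ?D (\<lambda>f. \<phi> f - \<psi> f) + vnorm ?D (\<lambda>f. \<phi>' f - \<psi>' f)"
      proof (rule dual_norm_le)
        fix f assume f: "f \<in> vecs (Lip0 M p)" "1-lipschitz_on M f"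
        show "\<bar>\<phi> f + \<phi>' f - (\<psi> f + \<psi>' f)\<bar> \<le>
            vnorm ?D (\<lambda>f. \<phi> f - \<psi> f) + vnorm ?D (\<lambda>f. \<phi>' f - \<psi>' f)"
          using dual_norm_bound[OF dual_Lip0_diff_mem[OF dual(1) span[OF \<psi>(1)]] f]
            dual_norm_bound[OF dual_Lip0_diff_mem[OF dual(2) span[OF \<psi>'(1)]] f] by simp
      qed
      then have "vnorm ?D (\<lambda>f. \<phi> f + \<phi>' f - (\<psi> f + \<psi>' f)) < e"
        using \<psi>(2) \<psi>'(2) by linarith
      then show ?thesis by (rule bexI[OF _ evaluation_span_add[OF \<psi>(1) \<psi>'(1)]])
    qed
    then show ?thesis
      using dual_Lip0_add_mem[OF dual] by (auto simp: lipschitz_free_mem)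
  qed
  moreover have "(\<lambda>f. c * \<phi> f) \<in> vecs (lipschitz_free M p)"
    if \<phi>: "\<phi> \<in> vecs (lipschitz_free M p)" for c \<phi>
  proof -
    have dual: "\<phi> \<in> vecs ?D"
      using \<phi> by (auto simp: lipschitz_free_mem)
    have "\<exists>\<psi>\<in>evaluation_span M p. vnorm ?D (\<lambda>f. c * \<phi> f - \<psi> f) < e" if "e > 0" for e
    proof -
      \<comment> \<open>The summand 1 keeps the divisor positive when \<open>c = 0\<close>.\<close>
      let ?k = "\<bar>c\<bar> + 1"
      have "e / ?k > 0" using \<open>e > 0\<close> by simp
      then obtain \<psi> where \<psi>: "\<psi> \<in> evaluation_span M p" "vnorm ?D (\<lambda>f. \<phi> f - \<psi> f) < e / ?k"
        using \<phi> unfolding lipschitz_free_mem by blast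
      have "vnorm ?D (\<lambda>f. c * \<phi> f - c * \<psi> f) \<le> ?k * vnorm ?D (\<lambda>f. \<phi> f - \<psi> f)"
      proof (rule dual_norm_le)
        fix f assume f: "f \<in> vecs (Lip0 M p)" "1-lipschitz_on M f"
        have "\<bar>c * \<phi> f - c * \<psi> f\<bar> = \<bar>c\<bar> * \<bar>\<phi> f - \<psi> f\<bar>"
          by (simp flip: abs_mult right_diff_distrib)
        also have "\<dots> \<le> ?k * vnorm ?D (\<lambda>f. \<phi> f - \<psi> f)"
          using dual_norm_bound[OF dual_Lip0_diff_mem[OF dual span[OF \<psi>(1)]] f]
          by (intro mult_mono) auto
        finally show "\<bar>c * \<phi> f - c * \<psi> f\<bar> \<le> ?k * vnorm ?D (\<lambda>f. \<phi> f - \<psi> f)" .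
      qed
      also have "\<dots> < e" using \<psi>(2) by (simp add: field_simps)
      finally show ?thesis by (rule bexI[OF _ evaluation_span_cmult[OF \<psi>(1)]])
    qed
    then show ?thesis
      using dual_Lip0_cmult_mem[OF dual] by (auto simp: lipschitz_free_mem)
  qed
  moreover have "vnorm (lipschitz_free M p) \<phi> \<ge> 0" if "\<phi> \<in> vecs (lipschitz_free M p)" for \<phi>
    using that dual_norm_nonneg by (auto simp: lipschitz_free_mem)
  ultimately show ?thesis by (simp add: normed_subspace_def)
qed

lemma lipschitz_free_isomorphic_trans:
  assumes "isomorphic (lipschitz_free M p) (lipschitz_free N q)"
    and "isomorphic (lipschitz_free N q) (lipschitz_free L r)"
    and "p \<in> M" "q \<in> N" "r \<in> L"
  shows "isomorphic (lipschitz_free M p) (lipschitz_free L r)"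
  using assms(1,2) by (rule isomorphic_trans) (intro normed_subspace_lipschitz_free assms)+

section \<open>Operators on Lipschitz functions and their adjoints on free spaces\<close>

text \<open>\<open>A\<close> takes functions on \<open>N\<close> to functions on \<open>M\<close>.
  The pointwise condition makes \<open>A\<close> linear on \<open>M\<close> and forces its adjoint
  to send point evaluations into the span of point evaluations, so that the adjoint restricts from
  the duals to the free spaces.\<close>

definition lipschitz_operator ::
    "'b::metric_space set \<Rightarrow> 'b \<Rightarrow> 'a::metric_space set \<Rightarrow> 'a \<Rightarrow> (('b \<Rightarrow> real) \<Rightarrow> 'a \<Rightarrow> real) \<Rightarrow> bool" where
  "lipschitz_operator N q M p A \<longleftrightarrow>
     (\<forall>x\<in>M. finite_combination N (\<lambda>f. A f x)) \<and>
     (\<exists>K. \<forall>C f. C-lipschitz_on N f \<and> f q = 0 \<longrightarrow> A f p = 0 \<and> (K * C)-lipschitz_on M (A f))"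

text \<open>The adjoint of \<open>A\<close>, from functionals on \<open>M\<close> to functionals on
  \<open>N\<close>. The inner cutoff yields the representative of \<open>A f\<close> that vanishes
  off \<open>M\<close>; the outer one is the convention for functionals off the carrier.\<close>

definition free_pullback ::
    "'b::metric_space set \<Rightarrow> 'b \<Rightarrow> 'a set \<Rightarrow> (('b \<Rightarrow> real) \<Rightarrow> 'a \<Rightarrow> real) \<Rightarrow>
      (('a \<Rightarrow> real) \<Rightarrow> real) \<Rightarrow> ('b \<Rightarrow> real) \<Rightarrow> real" where
  "free_pullback N q M A \<phi> =
     (\<lambda>f. if f \<in> vecs (Lip0 N q) then \<phi> (\<lambda>x. if x \<in> M then A f x else 0) else 0)"

text \<open>The adjoint is bounded between the duals and maps evaluation span into evaluation span;
  by continuity it maps the closure of the one into the closure of the other.\<close>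

lemma bounded_linear_map_free_pullback:
  fixes M :: "'a::metric_space set" and N :: "'b::metric_space set"
  assumes A: "lipschitz_operator N q M p A" and pq: "p \<in> M" "q \<in> N"
  shows "bounded_linear_map (lipschitz_free M p) (lipschitz_free N q) (free_pullback N q M A)"
proof -
  let ?A = "\<lambda>f x. if x \<in> M then A f x else 0"
  let ?D = "dual_space (Lip0 M p)" and ?E = "dual_space (Lip0 N q)"
  let ?T = "free_pullback N q M A"
  have fc: "\<And>x. x \<in> M \<Longrightarrow> finite_combination N (\<lambda>f. A f x)"
    using A by (auto simp: lipschitz_operator_def)
  obtain K0 where K0: "\<And>C f. C-lipschitz_on N f \<Longrightarrow> f q = 0 \<Longrightarrow> A f p = 0 \<and> (K0 * C)-lipschitz_on M (A f)"
    using A by (auto simp: lipschitz_operator_def)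
  \<comment> \<open>Made strictly positive, so that \<open>e / K\<close> makes sense and
    \<open>dual_norm_bound\<close> applies with constant \<open>K\<close>.\<close>
  define K where "K = \<bar>K0\<bar> + 1"
  have K: "K > 0" by (simp add: K_def)
  have lip: "(K * C)-lipschitz_on M (?A f)" if "C-lipschitz_on N f" "f q = 0" for C f
  proof -
    have "(K * C)-lipschitz_on M (A f)"
      using conjunct2[OF K0[OF that]]
      by (rule lipschitz_on_le)
        (use lipschitz_on_nonneg[OF that(1)] in \<open>auto intro!: mult_right_mono simp: K_def\<close>)
    then show ?thesis by (auto simp: lipschitz_on_def)
  qed
  have mem: "?A f \<in> vecs (Lip0 M p)" if f: "f \<in> vecs (Lip0 N q)" for f
  proof -
    obtain C where "C-lipschitz_on N f" "f q = 0" using f by (auto simp: Lip0_mem)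
    then show ?thesis using lip[of C f] K0[of C f] pq by (auto simp: Lip0_mem)
  qed
  have add: "?A (\<lambda>x. f x + g x) = (\<lambda>x. ?A f x + ?A g x)" for f g
    using finite_combination_linear(1)[OF fc] by fastforce
  have cmult: "?A (\<lambda>x. c * f x) = (\<lambda>x. c * ?A f x)" for c f
    using finite_combination_linear(2)[OF fc] by fastforce
  have T_dual: "?T \<phi> \<in> vecs ?E" if \<phi>: "\<phi> \<in> vecs ?D" for \<phi>
  proof -
    obtain B where B: "\<And>C f. f \<in> vecs (Lip0 M p) \<Longrightarrow> C-lipschitz_on M f \<Longrightarrow> \<bar>\<phi> f\<bar> \<le> B * C"
      using \<phi> unfolding dual_Lip0_iff by blast
    have "\<bar>\<phi> (?A f)\<bar> \<le> (B * K) * C" if "f \<in> vecs (Lip0 N q)" "C-lipschitz_on N f" for C f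
      using B[OF mem[OF that(1)] lip[OF that(2)]] that(1) by (simp add: mult.assoc Lip0_mem)
    then have "\<exists>B. \<forall>C f. f \<in> vecs (Lip0 N q) \<and> C-lipschitz_on N f \<longrightarrow> \<bar>\<phi> (?A f)\<bar> \<le> B * C"
      by blast
    moreover have "\<phi> (\<lambda>x. ?A f x + ?A g x) = \<phi> (?A f) + \<phi> (?A g)"
      if "f \<in> vecs (Lip0 N q)" "g \<in> vecs (Lip0 N q)" for f g
      using dual_Lip0_linear(1)[OF \<phi> mem[OF that(1)] mem[OF that(2)]] .
    moreover have "\<phi> (\<lambda>x. c * ?A f x) = c * \<phi> (?A f)" if "f \<in> vecs (Lip0 N q)" for f c
      using dual_Lip0_linear(2)[OF \<phi> mem[OF that]] .
    ultimately show ?thesis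
      unfolding dual_Lip0_iff free_pullback_def add cmult
      by (simp add: Lip0_add_mem Lip0_smul_mem)
  qed
  have T_norm: "vnorm ?E (?T \<phi>) \<le> K * vnorm ?D \<phi>" if \<phi>: "\<phi> \<in> vecs ?D" for \<phi>
  proof (rule dual_norm_le)
    fix f assume f: "f \<in> vecs (Lip0 N q)" "1-lipschitz_on N f"
    have "\<bar>\<phi> (?A f)\<bar> \<le> K * vnorm ?D \<phi>"
      using dual_norm_bound[OF \<phi> mem[OF f(1)], of K] lip[of 1 f] f K by (simp add: Lip0_mem)
    then show "\<bar>?T \<phi> f\<bar> \<le> K * vnorm ?D \<phi>"
      using f by (simp add: free_pullback_def)
  qed
  have T_diff: "(\<lambda>f. ?T \<phi> f - ?T \<psi> f) = ?T (\<lambda>f. \<phi> f - \<psi> f)" for \<phi> \<psi>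
    by (auto simp: free_pullback_def fun_eq_iff)
  have T_span: "?T \<psi> \<in> evaluation_span N q" if \<psi>: "\<psi> \<in> evaluation_span M p" for \<psi>
  proof -
    obtain \<phi> where \<phi>: "finite_combination M \<phi>"
      and \<psi>: "\<psi> = (\<lambda>f. if f \<in> vecs (Lip0 M p) then \<phi> f else 0)"
      using \<psi> by (auto simp: evaluation_span_iff)
    obtain B c where B: "finite B" "B \<subseteq> M" "\<And>f. \<phi> f = (\<Sum>x\<in>B. c x * f x)"
      using \<phi> by (auto simp: finite_combination_def)
    have "finite_combination N (\<lambda>f. \<Sum>x\<in>B. c x * A f x)"
      using B fc by (intro finite_combination_sum finite_combination_cmult) auto
    moreover have "\<phi> (?A f) = (\<Sum>x\<in>B. c x * A f x)" for f
      unfolding B(3) using B(2) by (intro sum.cong) auto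
    ultimately have "finite_combination N (\<lambda>f. \<phi> (?A f))" by simp
    moreover have "?T \<psi> = (\<lambda>f. if f \<in> vecs (Lip0 N q) then \<phi> (?A f) else 0)"
      unfolding free_pullback_def \<psi> using mem by (auto simp: fun_eq_iff)
    ultimately show ?thesis unfolding evaluation_span_iff by blast
  qed
  have "?T \<phi> \<in> vecs (lipschitz_free N q)" if \<phi>: "\<phi> \<in> vecs (lipschitz_free M p)" for \<phi>
  proof -
    have "\<exists>\<psi>\<in>evaluation_span N q. vnorm ?E (\<lambda>f. ?T \<phi> f - \<psi> f) < e" if "e > 0" for e
    proof -
      obtain \<psi> where \<psi>: "\<psi> \<in> evaluation_span M p" "vnorm ?D (\<lambda>f. \<phi> f - \<psi> f) < e / K"
        using \<phi> divide_pos_pos[OF \<open>e > 0\<close> K] unfolding lipschitz_free_mem by blast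
      have "vnorm ?E (\<lambda>f. ?T \<phi> f - ?T \<psi> f) \<le> K * vnorm ?D (\<lambda>f. \<phi> f - \<psi> f)"
        unfolding T_diff using \<psi> \<phi> evaluation_span_subset_dual[OF pq(1)]
        by (intro T_norm dual_Lip0_diff_mem) (auto simp: lipschitz_free_mem)
      also have "\<dots> < e" using \<psi>(2) K by (simp add: field_simps)
      finally show ?thesis by (rule bexI[OF _ T_span[OF \<psi>(1)]])
    qed
    then show ?thesis using T_dual \<phi> unfolding lipschitz_free_mem by blast
  qed
  moreover have "?T (\<lambda>f. \<phi> f + \<psi> f) = (\<lambda>f. ?T \<phi> f + ?T \<psi> f)"
    "?T (\<lambda>f. c * \<phi> f) = (\<lambda>f. c * ?T \<phi> f)" for \<phi> \<psi> c
    by (auto simp: free_pullback_def)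
  moreover have "\<forall>\<phi>\<in>vecs (lipschitz_free M p). vnorm ?E (?T \<phi>) \<le> K * vnorm ?D \<phi>"
    using T_norm by (simp add: lipschitz_free_mem)
  ultimately show ?thesis
    unfolding bounded_linear_map_def lipschitz_free_simps by blast
qed

lemma lipschitz_free_isomorphicI:
  fixes M :: "'a::metric_space set" and N :: "'b::metric_space set"
  assumes A: "lipschitz_operator N q M p A" and B: "lipschitz_operator M p N q B"
    and pq: "p \<in> M" "q \<in> N"
    and BA: "\<And>f y. y \<in> N \<Longrightarrow> f q = 0 \<Longrightarrow> B (A f) y = f y"
    and AB: "\<And>g x. x \<in> M \<Longrightarrow> g p = 0 \<Longrightarrow> A (B g) x = g x"
  shows "isomorphic (lipschitz_free M p) (lipschitz_free N q)"
proof -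
  have mem: "(\<lambda>x. if x \<in> M then A f x else 0) \<in> vecs (Lip0 M p)"
    if A: "lipschitz_operator N q M p A" and p: "p \<in> M" and f: "f \<in> vecs (Lip0 N q)"
    for M :: "'c::metric_space set" and N :: "'d::metric_space set" and p q A f
  proof -
    obtain C where C: "C-lipschitz_on N f" "f q = 0" using f by (auto simp: Lip0_mem)
    then obtain K where "(K * C)-lipschitz_on M (A f)" "A f p = 0"
      using A unfolding lipschitz_operator_def by blast
    then show ?thesis using p by (auto intro!: exI[of _ "K * C"] simp: Lip0_mem lipschitz_on_def)
  qed
  \<comment> \<open>Stated for generic spaces, since both compositions are obtained from it by
    exchanging \<open>M\<close> and \<open>N\<close>.\<close>
  have inverse: "free_pullback M p N B (free_pullback N q M A \<phi>) = \<phi>"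
    if A: "lipschitz_operator N q M p A" and B: "lipschitz_operator M p N q B"
      and pq: "p \<in> M" "q \<in> N"
      and AB: "\<And>g x. x \<in> M \<Longrightarrow> g p = 0 \<Longrightarrow> A (B g) x = g x"
      and \<phi>: "\<phi> \<in> vecs (lipschitz_free M p)"
    for M :: "'c::metric_space set" and N :: "'d::metric_space set" and p q A B \<phi>
  proof
    fix g
    show "free_pullback M p N B (free_pullback N q M A \<phi>) g = \<phi> g"
    proof (cases "g \<in> vecs (Lip0 M p)")
      case True
      let ?B = "\<lambda>y. if y \<in> N then B g y else 0"
      have "(\<lambda>x. if x \<in> M then A ?B x else 0) = g"
      proof
        fix x
        show "(if x \<in> M then A ?B x else 0) = g x"
        proof (cases "x \<in> M")
          case xM: True
          \<comment> \<open>\<open>B g\<close> may be nonzero off \<open>N\<close> whereas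
            \<open>?B\<close> is cut off there; a finite combination of values on \<open>N\<close>
            does not notice.\<close>
          have "A ?B x = A (B g) x"
            using A xM by (intro finite_combination_cong[of N "\<lambda>f. A f x"])
              (auto simp: lipschitz_operator_def)
          then show ?thesis using AB[of x g] True xM by (simp add: Lip0_mem)
        qed (use True in \<open>auto simp: Lip0_mem\<close>)
      qed
      then show ?thesis
        using mem[OF B pq(2) True] True by (simp add: free_pullback_def)
    next
      case False
      then show ?thesis
        using \<phi> unfolding lipschitz_free_mem dual_Lip0_iff free_pullback_def by simp
    qed
  qed
  show ?thesis
  proof (rule isomorphicI)
    show "normed_subspace (lipschitz_free N q)"
      using normed_subspace_lipschitz_free[OF pq(2)] .
    show "bounded_linear_map (lipschitz_free M p) (lipschitz_free N q) (free_pullback N q M A)"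
      using bounded_linear_map_free_pullback[OF A pq] .
    show "bounded_linear_map (lipschitz_free N q) (lipschitz_free M p) (free_pullback M p N B)"
      using bounded_linear_map_free_pullback[OF B pq(2,1)] .
    show "free_pullback M p N B (free_pullback N q M A \<phi>) = \<phi>"
      if "\<phi> \<in> vecs (lipschitz_free M p)" for \<phi>
      using inverse[OF A B pq AB that] .
    show "free_pullback N q M A (free_pullback M p N B \<psi>) = \<psi>"
      if "\<psi> \<in> vecs (lipschitz_free N q)" for \<psi>
      using inverse[OF B A pq(2,1) BA that] .
  qed
qed

lemma lipschitz_operatorI:
  assumes "\<And>x. x \<in> M \<Longrightarrow> finite_combination N (\<lambda>f. A f x)"
    and "\<And>f. f q = 0 \<Longrightarrow> A f p = 0"
    and "\<And>C f x y. C-lipschitz_on N f \<Longrightarrow> f q = 0 \<Longrightarrow> x \<in> M \<Longrightarrow> y \<in> M \<Longrightarrow>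
      \<bar>A f x - A f y\<bar> \<le> K * C * dist x y"
    and "K \<ge> 0"
  shows "lipschitz_operator N q M p A"
  unfolding lipschitz_operator_def
  using assms
  by (intro conjI exI[of _ K] allI impI lipschitz_onI)
    (auto simp: dist_real_def intro: mult_nonneg_nonneg lipschitz_on_nonneg)

text \<open>Subtracting the value at the new base point leaves all differences unchanged;
  subtracting the value at the old one undoes it.\<close>

lemma isomorphic_lipschitz_free_base_point:
  assumes "p \<in> M" "q \<in> M"
  shows "isomorphic (lipschitz_free M p) (lipschitz_free M q)"
proof -
  have "lipschitz_operator M q M p (\<lambda>f x. f x - f p)" if "p \<in> M" for p q
    using that
    by (intro lipschitz_operatorI[where K = 1])
      (auto intro!: finite_combination_intros dest: lipschitz_onD simp: dist_real_def)
  from this[OF assms(1)] this[OF assms(2)] show ?thesis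
    by (rule lipschitz_free_isomorphicI) (use assms in auto)
qed

text \<open>Composition with \<open>T\<close> and composition with \<open>U\<close> are mutually
  inverse operators on Lipschitz functions, each a single point value at every point.\<close>

lemma isomorphic_lipschitz_free_bilipschitz:
  assumes T: "K-lipschitz_on M T" "T ` M \<subseteq> N" and U: "L-lipschitz_on N U" "U ` N \<subseteq> M"
    and UT: "\<And>x. x \<in> M \<Longrightarrow> U (T x) = x" and TU: "\<And>y. y \<in> N \<Longrightarrow> T (U y) = y"
    and p: "p \<in> M"
  shows "isomorphic (lipschitz_free M p) (lipschitz_free N (T p))"
proof -
  have "lipschitz_operator N q M p (\<lambda>f x. f (T x))"
    if T: "K-lipschitz_on M T" "T ` M \<subseteq> N" and q: "T p = q"
    for M :: "'c::metric_space set" and N :: "'d::metric_space set" and p q T K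
  proof (rule lipschitz_operatorI)
    fix C x y and f :: "'d \<Rightarrow> real"
    assume "C-lipschitz_on N f" "x \<in> M" "y \<in> M"
    then have "(C * K)-lipschitz_on M (\<lambda>x. f (T x))"
      using T by (intro lipschitz_on_compose2) (auto intro: lipschitz_on_subset)
    from lipschitz_onD[OF this \<open>x \<in> M\<close> \<open>y \<in> M\<close>]
    show "\<bar>f (T x) - f (T y)\<bar> \<le> K * C * dist x y"
      by (simp add: dist_real_def mult.commute[of C])
  qed (use T q lipschitz_on_nonneg in \<open>auto intro: finite_combination_point\<close>)
  from this[OF T refl] this[OF U UT[OF p]] show ?thesis
    by (rule lipschitz_free_isomorphicI) (use assms in auto)
qed


subsection \<open>Adding an isolated point\<close>

text \<open>Piecewise linear through the points \<open>(n, a n)\<close> for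
  \<open>t \<ge> 0\<close>, the only range in which it is used.\<close>

definition interpolation :: "(nat \<Rightarrow> real) \<Rightarrow> real \<Rightarrow> real" where
  "interpolation a t = a (nat \<lfloor>t\<rfloor>) + (t - of_int \<lfloor>t\<rfloor>) * (a (Suc (nat \<lfloor>t\<rfloor>)) - a (nat \<lfloor>t\<rfloor>))"

lemma interpolation_of_nat [simp]: "interpolation a (real n) = a n"
  by (simp add: interpolation_def)

lemma abs_sequence_diff_le:
  fixes a :: "nat \<Rightarrow> real"
  assumes "\<And>n. \<bar>a (Suc n) - a n\<bar> \<le> K" "m \<le> n"
  shows "\<bar>a n - a m\<bar> \<le> K * (real n - real m)"
  using assms(2)
proof (induction n rule: dec_induct)
  case (step n)
  then show ?case using assms(1)[of n] abs_triangle_ineq[of "a (Suc n) - a n" "a n - a m"]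
    by (simp add: algebra_simps)
qed simp

lemma interpolation_lipschitz:
  assumes a: "\<And>n. \<bar>a (Suc n) - a n\<bar> \<le> K" and "s \<ge> 0" "t \<ge> 0"
  shows "\<bar>interpolation a s - interpolation a t\<bar> \<le> K * \<bar>s - t\<bar>"
proof -
  have *: "\<bar>interpolation a t - interpolation a s\<bar> \<le> K * (t - s)" if "0 \<le> s" "s \<le> t" for s t
  proof -
    define m where "m = nat \<lfloor>s\<rfloor>"
    define n where "n = nat \<lfloor>t\<rfloor>"
    have m: "real_of_int \<lfloor>s\<rfloor> = real m" "real m \<le> s" "s \<le> real m + 1"
      using that unfolding m_def by linarith+
    have n: "real_of_int \<lfloor>t\<rfloor> = real n" "real n \<le> t" "t \<le> real n + 1"
      using that unfolding n_def by linarith+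
    have "m \<le> n"
      using that unfolding m_def n_def by (intro nat_mono floor_mono)
    have s_eq: "interpolation a s = a m + (s - m) * (a (Suc m) - a m)"
      unfolding interpolation_def m(1) m_def[symmetric] ..
    have t_eq: "interpolation a t = a n + (t - n) * (a (Suc n) - a n)"
      unfolding interpolation_def n(1) n_def[symmetric] ..
    show ?thesis
    proof (cases "m = n")
      case True
      have "interpolation a t - interpolation a s = (t - s) * (a (Suc m) - a m)"
        unfolding s_eq t_eq True by (simp add: algebra_simps)
      then show ?thesis
        using a[of m] that mult_left_mono[OF a[of m], of "t - s"] by (simp add: abs_mult mult.commute)
    next
      case False
      then have "Suc m \<le> n" using \<open>m \<le> n\<close> by simp
      \<comment> \<open>The interval is cut at the integers \<open>Suc m\<close> and
        \<open>n\<close> into two partial cells and a telescoping run of whole cells; the lengths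
        add up to \<open>t - s\<close>.\<close>
      have "interpolation a t - interpolation a s =
          (t - n) * (a (Suc n) - a n) + (a n - a (Suc m)) + (Suc m - s) * (a (Suc m) - a m)"
        unfolding s_eq t_eq by (simp add: algebra_simps)
      moreover have "\<bar>(t - n) * (a (Suc n) - a n)\<bar> \<le> (t - n) * K"
        using a[of n] n by (simp add: abs_mult mult_left_mono)
      moreover have "\<bar>(Suc m - s) * (a (Suc m) - a m)\<bar> \<le> (Suc m - s) * K"
        using a[of m] m by (simp add: abs_mult mult_left_mono)
      moreover have "\<bar>a n - a (Suc m)\<bar> \<le> K * (real n - real (Suc m))"
        using abs_sequence_diff_le[of a K, OF a \<open>Suc m \<le> n\<close>] .
      ultimately have "\<bar>interpolation a t - interpolation a s\<bar> \<le>
          (t - n) * K + K * (real n - real (Suc m)) + (Suc m - s) * K"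
        by linarith
      also have "\<dots> = K * (t - s)" by (simp add: algebra_simps)
      finally show ?thesis .
    qed
  qed
  show ?thesis
    using *[of s t] *[of t s] assms(2,3) by (cases "s \<le> t") (auto simp: abs_minus_commute)
qed

lemma finite_combination_interpolation:
  assumes "\<And>n. finite_combination M (\<lambda>f. a f n)"
  shows "finite_combination M (\<lambda>f. interpolation (a f) t)"
  unfolding interpolation_def by (intro finite_combination_intros assms)

text \<open>
  The values along the ray \<open>0, v, 2v, \<dots>\<close> span a complemented copy of a sequence space in which
  a shift by one place absorbs the additional value at \<open>0\<close>.
\<close>

lemma isomorphic_lipschitz_free_insert:
  fixes M :: "'a::real_normed_vector set"
  assumes v: "norm v = 1" "\<And>n. real n *\<^sub>R v \<in> M"
    and e: "norm e = 1" "e \<notin> M" and K: "\<And>x. x \<in> M \<Longrightarrow> 1 \<le> K * norm (x - e)"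
  shows "isomorphic (lipschitz_free (insert e M) e) (lipschitz_free M 0)"
proof -
  let ?r = "\<lambda>(f :: 'a \<Rightarrow> real) n. f (real n *\<^sub>R v)"
  \<comment> \<open>The leading 0 is the value at the base point \<open>e\<close>: the sequence
    lists the values of \<open>f\<close> at \<open>e, 0, v, 2v, ...\<close>.\<close>
  let ?s = "\<lambda>(f :: 'a \<Rightarrow> real) n. case n of 0 \<Rightarrow> 0 | Suc k \<Rightarrow> f (real k *\<^sub>R v)"
  \<comment> \<open>The profile of \<open>f\<close> along the ray, spread out as a function of the
    norm, is exchanged for the shifted one. As \<open>n v\<close> has norm \<open>n\<close>, the
    values on the ray are shifted exactly.\<close>
  define V where "V = (\<lambda>f x. f x - interpolation (?r f) (norm x) + interpolation (?s f) (norm x))"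
  define W where "W = (\<lambda>g x. if x = e then 0 else
    g x - interpolation (?r g) (norm x) + interpolation (\<lambda>n. ?r g (Suc n)) (norm x))"
  have "0 \<in> M" using v(2)[of 0] by simp
  have step: "norm (real (Suc n) *\<^sub>R v - real n *\<^sub>R v) = 1" for n
    using v(1) by (simp flip: scaleR_diff_left)
  have r_step: "\<bar>?r f (Suc n) - ?r f n\<bar> \<le> C" if "C-lipschitz_on M f" for C f n
    using lipschitz_onD[OF that v(2)[of "Suc n"] v(2)[of n]] step[of n]
    by (simp add: dist_real_def dist_norm)
  have interp: "\<bar>interpolation a (norm x) - interpolation a (norm y)\<bar> \<le> C * norm (x - y)"
    if "\<And>n. \<bar>a (Suc n) - a n\<bar> \<le> C" for a C and x y :: 'a
  proof -
    have "\<bar>interpolation a (norm x) - interpolation a (norm y)\<bar> \<le> C * \<bar>norm x - norm y\<bar>"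
      using interpolation_lipschitz[of a C] that by simp
    also have "\<dots> \<le> C * norm (x - y)"
      using that[of 0] by (intro mult_left_mono norm_triangle_ineq3) auto
    finally show ?thesis .
  qed
  have V: "lipschitz_operator (insert e M) e M 0 V"
  proof (rule lipschitz_operatorI[where K = 3])
    fix x assume "x \<in> M"
    have "finite_combination (insert e M) (\<lambda>f. ?s f n)" for n
      using v(2) by (cases n) (auto intro: finite_combination_intros)
    then show "finite_combination (insert e M) (\<lambda>f. V f x)"
      unfolding V_def using v(2) \<open>x \<in> M\<close>
      by (intro finite_combination_intros finite_combination_interpolation) auto
  next
    fix f :: "'a \<Rightarrow> real" assume "f e = 0"
    show "V f 0 = 0"
      using interpolation_of_nat[of "?r f" 0] interpolation_of_nat[of "?s f" 0] by (simp add: V_def)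
  next
    fix C x y and f :: "'a \<Rightarrow> real"
    assume f: "C-lipschitz_on (insert e M) f" "f e = 0" and xy: "x \<in> M" "y \<in> M"
    have fM: "C-lipschitz_on M f" using f(1) by (rule lipschitz_on_subset) auto
    \<comment> \<open>The new first step, from \<open>e\<close> to \<open>0\<close>, has length
      \<open>norm e = 1\<close> like the steps along the ray.\<close>
    have "\<bar>?s f (Suc n) - ?s f n\<bar> \<le> C" for n
    proof (cases n)
      case 0
      then show ?thesis
        using lipschitz_onD[OF f(1), of 0 e] f(2) \<open>0 \<in> M\<close> e(1) by (simp add: dist_real_def)
    next
      case (Suc k)
      then show ?thesis using r_step[OF fM, of k] by simp
    qed
    then have "\<bar>interpolation (?s f) (norm x) - interpolation (?s f) (norm y)\<bar> \<le> C * norm (x - y)"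
      by (rule interp)
    moreover have "\<bar>interpolation (?r f) (norm x) - interpolation (?r f) (norm y)\<bar> \<le> C * norm (x - y)"
      using r_step[OF fM] by (rule interp)
    moreover have "\<bar>f x - f y\<bar> \<le> C * norm (x - y)"
      using lipschitz_onD[OF fM xy] by (simp add: dist_real_def dist_norm)
    ultimately have "\<bar>V f x - V f y\<bar> \<le> 3 * (C * norm (x - y))"
      unfolding V_def by linarith
    then show "\<bar>V f x - V f y\<bar> \<le> 3 * C * dist x y" by (simp add: dist_norm)
  qed simp
  have W: "lipschitz_operator M 0 (insert e M) e W"
  \<comment> \<open>Within \<open>M\<close> each of the three summands contributes 1. Against
    \<open>e\<close>, the bound \<open>C * (norm x + 1)\<close> is compared with
    \<open>norm (x - e)\<close> through \<open>norm x \<le> norm (x - e) + 1\<close> and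
    \<open>1 \<le> \<bar>K\<bar> * norm (x - e)\<close>.\<close>
  proof (rule lipschitz_operatorI[where K = "3 + 2 * \<bar>K\<bar>"])
    fix x assume "x \<in> insert e M"
    then show "finite_combination M (\<lambda>f. W f x)"
      unfolding W_def using v(2)
      by (cases "x = e")
        (auto intro!: finite_combination_intros finite_combination_interpolation simp del: of_nat_Suc)
  next
    fix C x y and g :: "'a \<Rightarrow> real"
    assume g: "C-lipschitz_on M g" "g 0 = 0" and xy: "x \<in> insert e M" "y \<in> insert e M"
    have C: "C \<ge> 0" using g(1) by (rule lipschitz_on_nonneg)
    let ?b = "\<lambda>n. ?r g (Suc n)"
    have MM: "\<bar>W g x - W g y\<bar> \<le> (3 + 2 * \<bar>K\<bar>) * C * norm (x - y)" if xy: "x \<in> M" "y \<in> M" for x y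
    proof -
      have "\<bar>interpolation ?b (norm x) - interpolation ?b (norm y)\<bar> \<le> C * norm (x - y)"
        using r_step[OF g(1)] by (rule interp)
      moreover have "\<bar>interpolation (?r g) (norm x) - interpolation (?r g) (norm y)\<bar> \<le> C * norm (x - y)"
        using r_step[OF g(1)] by (rule interp)
      moreover have "\<bar>g x - g y\<bar> \<le> C * norm (x - y)"
        using lipschitz_onD[OF g(1) xy] by (simp add: dist_real_def dist_norm)
      moreover have "x \<noteq> e" "y \<noteq> e" using xy e(2) by auto
      ultimately have "\<bar>W g x - W g y\<bar> \<le> 3 * (C * norm (x - y))"
        unfolding W_def by simp
      also have "\<dots> \<le> (3 + 2 * \<bar>K\<bar>) * (C * norm (x - y))"
        using C by (intro mult_right_mono) auto
      finally show ?thesis by (simp add: mult.assoc)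
    qed
    have Me: "\<bar>W g x\<bar> \<le> (3 + 2 * \<bar>K\<bar>) * C * norm (x - e)" if x: "x \<in> M" for x
    proof -
      have "\<bar>interpolation ?b t - interpolation (?r g) t\<bar> \<le> C" if "t \<ge> 0" for t
      proof -
        let ?n = "nat \<lfloor>t\<rfloor>" and ?q = "t - real_of_int \<lfloor>t\<rfloor>"
        have q: "?q \<ge> 0" "1 - ?q \<ge> 0" by linarith+
        \<comment> \<open>The difference is a convex combination of two consecutive steps along the
          ray, each at most \<open>C\<close>.\<close>
        have "interpolation ?b t - interpolation (?r g) t =
            (1 - ?q) * (?b ?n - ?r g ?n) + ?q * (?b (Suc ?n) - ?r g (Suc ?n))"
          unfolding interpolation_def by (simp add: algebra_simps)
        moreover have "\<bar>(1 - ?q) * (?b ?n - ?r g ?n)\<bar> \<le> (1 - ?q) * C"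
          using r_step[OF g(1), of ?n] q by (simp only: abs_mult abs_of_nonneg mult_left_mono)
        moreover have "\<bar>?q * (?b (Suc ?n) - ?r g (Suc ?n))\<bar> \<le> ?q * C"
          using r_step[OF g(1), of "Suc ?n"] q by (simp only: abs_mult abs_of_nonneg mult_left_mono)
        ultimately have "\<bar>interpolation ?b t - interpolation (?r g) t\<bar> \<le> (1 - ?q) * C + ?q * C"
          by linarith
        then show ?thesis by (simp add: algebra_simps)
      qed
      from this[of "norm x"]
      have "\<bar>interpolation ?b (norm x) - interpolation (?r g) (norm x)\<bar> \<le> C" by simp
      moreover have "\<bar>g x\<bar> \<le> C * norm x"
        using lipschitz_onD[OF g(1) x \<open>0 \<in> M\<close>] g(2) by (simp add: dist_real_def)
      ultimately have "\<bar>W g x\<bar> \<le> C * norm x + C"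
        using C unfolding W_def by auto
      also have "\<dots> = C * (norm x + 1)" by (simp add: algebra_simps)
      also have "\<dots> \<le> C * ((3 + 2 * \<bar>K\<bar>) * norm (x - e))"
      proof (intro mult_left_mono C)
        have "norm x \<le> norm (x - e) + 1"
          using norm_triangle_sub[of x e] e(1) by simp
        moreover have "1 \<le> \<bar>K\<bar> * norm (x - e)"
          using K[OF x] by (smt (verit) mult_right_mono norm_ge_zero)
        ultimately have "norm x + 1 \<le> (1 + 2 * \<bar>K\<bar>) * norm (x - e)"
          by (simp add: algebra_simps)
        also have "\<dots> \<le> (3 + 2 * \<bar>K\<bar>) * norm (x - e)"
          by (intro mult_right_mono) auto
        finally show "norm x + 1 \<le> (3 + 2 * \<bar>K\<bar>) * norm (x - e)" .
      qed
      finally show ?thesis by (simp add: mult_ac)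
    qed
    have "W g e = 0" by (simp add: W_def)
    then show "\<bar>W g x - W g y\<bar> \<le> (3 + 2 * \<bar>K\<bar>) * C * dist x y"
      using xy MM[of x y] Me[of x] Me[of y] by (auto simp: dist_norm norm_minus_commute)
  qed (auto simp: W_def)
  show ?thesis
  proof (rule lipschitz_free_isomorphicI[OF W V])
    have norm_v: "norm (real n *\<^sub>R v) = real n" for n using v(1) by simp
    show "V (W g) x = g x" if "x \<in> M" "g 0 = 0" for g x
    proof -
      have W_v: "W g (real n *\<^sub>R v) = g (real (Suc n) *\<^sub>R v)" for n
      proof -
        have "real n *\<^sub>R v \<noteq> e" using v(2)[of n] e(2) by auto
        then show ?thesis unfolding W_def norm_v interpolation_of_nat by simp
      qed
      \<comment> \<open>\<open>W\<close> drops the value at \<open>0\<close> from the sequence and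
        \<open>?s\<close> puts a 0 in front, which is the lost value because
        \<open>g 0 = 0\<close>.\<close>
      have "?s (W g) = ?r g"
        using that(2) by (auto simp: fun_eq_iff W_v split: nat.split)
      moreover have "?r (W g) = (\<lambda>n. ?r g (Suc n))"
        by (auto simp: W_v)
      moreover have "W g x = g x - interpolation (?r g) (norm x) +
          interpolation (\<lambda>n. ?r g (Suc n)) (norm x)"
        using that(1) e(2) by (auto simp: W_def)
      ultimately show ?thesis unfolding V_def by (simp only:)
    qed
    show "W (V f) x = f x" if "x \<in> insert e M" "f e = 0" for f x
    proof (cases "x = e")
      case True
      then show ?thesis using that by (simp add: W_def)
    next
      case False
      have V_v: "V f (real n *\<^sub>R v) = ?s f n" for n
        unfolding V_def norm_v interpolation_of_nat by simp
      have "?r (V f) = ?s f" "(\<lambda>n. ?r (V f) (Suc n)) = ?r f"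
        unfolding V_v by auto
      then show ?thesis
        using False unfolding W_def by (simp add: V_def)
    qed
  qed (use \<open>0 \<in> M\<close> in auto)
qed

subsection \<open>Stereographic projection\<close>

text \<open>Positive homogeneity merges the weight and the normalization of the weighted composition
  into one evaluation of a globally Lipschitz function.\<close>

definition radial_extension :: "('a::real_normed_vector \<Rightarrow> real) \<Rightarrow> 'a \<Rightarrow> real" where
  "radial_extension f z = norm z * f (sgn z)"

lemma radial_extension_scaleR:
  "k > 0 \<Longrightarrow> radial_extension f (k *\<^sub>R z) = k * radial_extension f z"
  by (simp add: radial_extension_def sgn_scaleR)

text \<open>Since \<open>f e = 0\<close> and the sphere has diameter at most 2,
  \<open>\<bar>f\<bar> \<le> 2 * C\<close> there. Changing the length first and then the direction
  costs \<open>2 * C\<close> each, relative to \<open>norm (x - y)\<close>.\<close>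

lemma radial_extension_lipschitz:
  fixes f :: "'a::real_normed_vector \<Rightarrow> real"
  assumes f: "C-lipschitz_on (sphere 0 1) f" and e: "e \<in> sphere 0 1" "f e = 0"
  shows "\<bar>radial_extension f x - radial_extension f y\<bar> \<le> 4 * C * norm (x - y)"
proof -
  have C: "C \<ge> 0" using f by (rule lipschitz_on_nonneg)
  have bound: "\<bar>f u\<bar> \<le> 2 * C" if "u \<in> sphere 0 1" for u
  proof -
    have "\<bar>f u\<bar> \<le> C * norm (u - e)"
      using lipschitz_onD[OF f that e(1)] e(2) by (simp add: dist_real_def dist_norm)
    also have "\<dots> \<le> C * 2"
      using norm_triangle_ineq4[of u e] that e(1) C by (intro mult_left_mono) auto
    finally show ?thesis by simp
  qed
  have sgn: "sgn z \<in> sphere 0 1" if "z \<noteq> 0" for z :: 'a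
    using that by (simp add: norm_sgn)
  have zero: "\<bar>radial_extension f z\<bar> \<le> 4 * C * norm z" for z
  proof (cases "z = 0")
    case False
    have "\<bar>radial_extension f z\<bar> \<le> norm z * (4 * C)"
      unfolding radial_extension_def abs_mult abs_norm_cancel
      using bound[OF sgn[OF False]] C by (intro mult_left_mono) auto
    then show ?thesis by (simp add: mult_ac)
  qed (simp add: radial_extension_def)
  show ?thesis
  proof (cases "x = 0 \<or> y = 0")
    case True
    then show ?thesis using zero[of x] zero[of y] by (auto simp: radial_extension_def)
  next
    case False
    then have xy: "x \<noteq> 0" "y \<noteq> 0" by auto
    have "radial_extension f x - radial_extension f y =
        (norm x - norm y) * f (sgn x) + norm y * (f (sgn x) - f (sgn y))"
      by (simp add: radial_extension_def algebra_simps)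
    moreover have "\<bar>(norm x - norm y) * f (sgn x)\<bar> \<le> norm (x - y) * (2 * C)"
      unfolding abs_mult using bound[OF sgn[OF xy(1)]] norm_triangle_ineq3[of x y]
      by (intro mult_mono) auto
    moreover have "\<bar>norm y * (f (sgn x) - f (sgn y))\<bar> \<le> C * (2 * norm (x - y))"
    proof -
      have "norm y *\<^sub>R (sgn x - sgn y) = (norm y - norm x) *\<^sub>R sgn x + (x - y)"
        using xy by (simp add: sgn_div_norm algebra_simps)
      then have "norm (norm y *\<^sub>R (sgn x - sgn y)) \<le> norm ((norm y - norm x) *\<^sub>R sgn x) + norm (x - y)"
        by (metis norm_triangle_ineq)
      then have "norm y * norm (sgn x - sgn y) \<le> 2 * norm (x - y)"
        using norm_triangle_ineq3[of y x] xy by (simp add: norm_sgn norm_minus_commute)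
      then have "C * (norm y * norm (sgn x - sgn y)) \<le> C * (2 * norm (x - y))"
        using C by (intro mult_left_mono)
      moreover have "\<bar>f (sgn x) - f (sgn y)\<bar> \<le> C * norm (sgn x - sgn y)"
        using lipschitz_onD[OF f sgn[OF xy(1)] sgn[OF xy(2)]] by (simp add: dist_real_def dist_norm)
      then have "norm y * \<bar>f (sgn x) - f (sgn y)\<bar> \<le> norm y * (C * norm (sgn x - sgn y))"
        by (intro mult_left_mono) auto
      ultimately show ?thesis
        by (simp add: abs_mult mult.left_commute)
    qed
    ultimately show ?thesis by (simp add: algebra_simps)
  qed
qed

lemma homogenization_lipschitz:
  fixes g :: "'a::real_normed_vector \<Rightarrow> real"
  assumes g: "C-lipschitz_on H g" "\<bar>g 0\<bar> \<le> C" and H: "0 \<in> H" "\<And>c z. z \<in> H \<Longrightarrow> c *\<^sub>R z \<in> H"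
    and xy: "x \<in> H" "y \<in> H" and l: "l > 0" and m: "m \<ge> 0" "m = 0 \<Longrightarrow> y = 0"
  shows "\<bar>l * g (x /\<^sub>R l) - m * g (y /\<^sub>R m)\<bar> \<le>
    C * (norm (x - y) + \<bar>l - m\<bar> * (1 + 2 * norm x / l))"
proof -
  have C: "C \<ge> 0" using g(1) by (rule lipschitz_on_nonneg)
  have "\<bar>g (x /\<^sub>R l) - g 0\<bar> \<le> C * (norm x / l)"
    using lipschitz_onD[OF g(1) H(2)[OF xy(1)] H(1), of "inverse l"] l
    by (simp add: dist_real_def divide_inverse mult.commute)
  then have bound: "\<bar>g (x /\<^sub>R l)\<bar> \<le> C * (1 + norm x / l)"
    using g(2) by (simp add: distrib_left)
  show ?thesis
  proof (cases "m = 0")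
    case True
    have "\<bar>l * g (x /\<^sub>R l)\<bar> \<le> l * (C * (1 + norm x / l))"
      unfolding abs_mult using bound l by (intro mult_mono) auto
    also have "\<dots> \<le> C * (norm x + l * (1 + 2 * norm x / l))"
      using l C by (simp add: field_simps)
    finally show ?thesis using True m(2) l by simp
  next
    case False
    with m have m0: "m > 0" by simp
    have "l * g (x /\<^sub>R l) - m * g (y /\<^sub>R m) =
        (l - m) * g (x /\<^sub>R l) + m * (g (x /\<^sub>R l) - g (y /\<^sub>R m))"
      by (simp add: algebra_simps)
    moreover have "\<bar>(l - m) * g (x /\<^sub>R l)\<bar> \<le> \<bar>l - m\<bar> * (C * (1 + norm x / l))"
      unfolding abs_mult using bound by (intro mult_left_mono) auto
    moreover have "\<bar>m * (g (x /\<^sub>R l) - g (y /\<^sub>R m))\<bar> \<le> C * (norm (x - y) + \<bar>l - m\<bar> * (norm x / l))"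
    proof -
      \<comment> \<open>Multiplying by \<open>m\<close> frees \<open>y\<close> of its scale; the
        mismatch of the scales remains as a multiple of \<open>x\<close>.\<close>
      have "m *\<^sub>R (x /\<^sub>R l - y /\<^sub>R m) = (x - y) + ((m - l) / l) *\<^sub>R x"
        using l m0 by (simp add: algebra_simps divide_inverse)
      then have "norm (m *\<^sub>R (x /\<^sub>R l - y /\<^sub>R m)) \<le> norm (x - y) + norm (((m - l) / l) *\<^sub>R x)"
        by (metis norm_triangle_ineq)
      then have "m * norm (x /\<^sub>R l - y /\<^sub>R m) \<le> norm (x - y) + \<bar>l - m\<bar> * (norm x / l)"
        using l m0 by (simp add: abs_minus_commute)
      then have "C * (m * norm (x /\<^sub>R l - y /\<^sub>R m)) \<le> C * (norm (x - y) + \<bar>l - m\<bar> * (norm x / l))"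
        using C by (intro mult_left_mono)
      moreover have "\<bar>g (x /\<^sub>R l) - g (y /\<^sub>R m)\<bar> \<le> C * norm (x /\<^sub>R l - y /\<^sub>R m)"
        using lipschitz_onD[OF g(1) H(2)[OF xy(1)] H(2)[OF xy(2)]] by (simp add: dist_real_def dist_norm)
      then have "m * \<bar>g (x /\<^sub>R l) - g (y /\<^sub>R m)\<bar> \<le> m * (C * norm (x /\<^sub>R l - y /\<^sub>R m))"
        using m0 by (intro mult_left_mono) auto
      ultimately show ?thesis
        unfolding abs_mult abs_of_pos[OF m0] mult.left_commute[of m C] by (rule order_trans[rotated])
    qed
    ultimately have "\<bar>l * g (x /\<^sub>R l) - m * g (y /\<^sub>R m)\<bar> \<le>
        \<bar>l - m\<bar> * (C * (1 + norm x / l)) + C * (norm (x - y) + \<bar>l - m\<bar> * (norm x / l))"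
      by linarith
    also have "\<dots> = C * (norm (x - y) + \<bar>l - m\<bar> * (1 + 2 * norm x / l))"
      by (simp add: algebra_simps)
    finally show ?thesis .
  qed
qed

section \<open>The lift of the hyperplane and its homogeneous inverse\<close>

text \<open>A substitute for the height \<open>r^2 - 1\<close> of the Euclidean stereographic
  projection: constantly -1 up to \<open>r = 1\<close>, then \<open>(r - 1)^2 - 1\<close>. With this
  choice \<open>t = \<lambda> * lift_height (a / \<lambda>)\<close> becomes
  \<open>t = a^2 / \<lambda> - 2 * a\<close> or \<open>t = -\<lambda>\<close>, solvable for
  \<open>\<lambda>\<close> without square roots.\<close>

definition lift_height :: "real \<Rightarrow> real" where
  "lift_height r = (max 1 r)\<^sup>2 - 2 * max 1 r"

definition cone_lift :: "'a::real_normed_vector \<Rightarrow> 'a \<Rightarrow> 'a" where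
  "cone_lift e x = x + lift_height (norm x) *\<^sub>R e"

text \<open>Splits off the quadratic growth; the remaining vector tends to \<open>e\<close>, where
  the radial extension vanishes, as \<open>norm x\<close> grows.\<close>

lemma cone_lift_eq_scaled:
  "cone_lift e x = (max 1 (norm x))\<^sup>2 *\<^sub>R
     (x /\<^sub>R (max 1 (norm x))\<^sup>2 + (1 - 2 / max 1 (norm x)) *\<^sub>R e)"
proof -
  have "(max 1 (norm x))\<^sup>2 * (1 - 2 / max 1 (norm x)) = lift_height (norm x)"
    by (simp add: lift_height_def right_diff_distrib power2_eq_square)
  moreover have "(max 1 (norm x))\<^sup>2 \<noteq> 0" by simp
  ultimately show ?thesis by (simp add: cone_lift_def scaleR_add_right)
qed

text \<open>With \<open>\<rho> = max 1 (norm x)\<close>, the rescaled lift lies within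
  \<open>3 / \<rho>\<close> of \<open>e\<close>, so the extension is at most
  \<open>12 * C / \<rho>\<close> there and only linear in \<open>\<rho>\<close> after multiplication
  by \<open>\<rho>^2\<close>. The constant 44 is 24 for the change of the factor
  \<open>\<rho>^2\<close> plus 20 for the change of the rescaled lift.\<close>

lemma radial_extension_cone_lift:
  fixes f :: "'a::real_normed_vector \<Rightarrow> real"
  assumes f: "C-lipschitz_on (sphere 0 1) f" and e: "norm e = 1" "f e = 0"
  shows "\<bar>radial_extension f (cone_lift e x)\<bar> \<le> 12 * C * max 1 (norm x)"
    and "\<bar>radial_extension f (cone_lift e x) - radial_extension f (cone_lift e y)\<bar> \<le>
      44 * C * norm (x - y)"
proof -
  let ?F = "radial_extension f"
  let ?\<rho> = "\<lambda>x::'a. max 1 (norm x)"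
  let ?z = "\<lambda>x. x /\<^sub>R (?\<rho> x)\<^sup>2 + (1 - 2 / ?\<rho> x) *\<^sub>R e"
  have C: "C \<ge> 0" using f by (rule lipschitz_on_nonneg)
  have e': "e \<in> sphere 0 1" using e(1) by simp
  have \<rho>: "?\<rho> x \<ge> 1" "(?\<rho> x)\<^sup>2 > 0" for x by auto
  have F_lift: "?F (cone_lift e x) = (?\<rho> x)\<^sup>2 * ?F (?z x)" for x
    unfolding cone_lift_eq_scaled[of e x] by (rule radial_extension_scaleR[OF \<rho>(2)])
  have F_z: "\<bar>?F (?z x)\<bar> \<le> 12 * C / ?\<rho> x" for x
  proof -
    have "?F e = 0" using e by (simp add: radial_extension_def sgn_div_norm)
    then have "\<bar>?F (?z x)\<bar> \<le> 4 * C * norm (?z x - e)"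
      using radial_extension_lipschitz[OF f e' e(2), of "?z x" e] by simp
    also have "\<dots> \<le> 4 * C * (3 / ?\<rho> x)"
    proof (intro mult_left_mono)
      have "?z x - e = x /\<^sub>R (?\<rho> x)\<^sup>2 - (2 / ?\<rho> x) *\<^sub>R e"
        by (simp add: algebra_simps)
      then have "norm (?z x - e) \<le> norm (x /\<^sub>R (?\<rho> x)\<^sup>2) + norm ((2 / ?\<rho> x) *\<^sub>R e)"
        by (metis norm_triangle_ineq4)
      also have "\<dots> = norm x / (?\<rho> x)\<^sup>2 + 2 / ?\<rho> x"
        using e(1) \<rho>[of x] by (simp add: divide_inverse mult.commute)
      also have "norm x / (?\<rho> x)\<^sup>2 \<le> ?\<rho> x / (?\<rho> x)\<^sup>2"
        by (intro divide_right_mono) auto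
      also have "?\<rho> x / (?\<rho> x)\<^sup>2 = 1 / ?\<rho> x"
        by (simp add: power2_eq_square)
      finally show "norm (?z x - e) \<le> 3 / ?\<rho> x" by (simp add: add_divide_distrib[symmetric])
    qed (use C in simp)
    finally show ?thesis by simp
  qed
  show "\<bar>?F (cone_lift e x)\<bar> \<le> 12 * C * ?\<rho> x"
  proof -
    have "\<bar>?F (cone_lift e x)\<bar> \<le> (?\<rho> x)\<^sup>2 * (12 * C / ?\<rho> x)"
      unfolding F_lift abs_mult using F_z[of x] by (intro mult_mono) auto
    also have "\<dots> = 12 * C * ?\<rho> x" using \<rho>[of x] by (simp add: power2_eq_square)
    finally show ?thesis .
  qed
  have *: "\<bar>?F (cone_lift e x) - ?F (cone_lift e y)\<bar> \<le> 44 * C * norm (x - y)"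
    if le: "norm y \<le> norm x" for x y
  proof -
    define r where "r = ?\<rho> x"
    define s where "s = ?\<rho> y"
    have rs: "1 \<le> s" "s \<le> r" "norm x \<le> r" using le by (auto simp: r_def s_def)
    have "r - s \<le> norm x - norm y" using le by (auto simp: r_def s_def)
    then have d: "r - s \<le> norm (x - y)" using norm_triangle_ineq2[of x y] by linarith
    have sq: "(r\<^sup>2 - s\<^sup>2) / r \<le> 2 * (r - s)"
    proof -
      have "r\<^sup>2 - s\<^sup>2 = (r - s) * (r + s)" by (simp add: power2_eq_square algebra_simps)
      also have "\<dots> \<le> (r - s) * (2 * r)" using rs by (intro mult_left_mono) auto
      finally show ?thesis using rs by (simp add: field_simps)
    qed
    have sq0: "r\<^sup>2 - s\<^sup>2 \<ge> 0" using rs by (simp add: power_mono)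
    have "?F (cone_lift e x) - ?F (cone_lift e y) =
        (r\<^sup>2 - s\<^sup>2) * ?F (?z x) + s\<^sup>2 * (?F (?z x) - ?F (?z y))"
      unfolding F_lift r_def s_def by (simp add: algebra_simps)
    moreover have "\<bar>(r\<^sup>2 - s\<^sup>2) * ?F (?z x)\<bar> \<le> 24 * C * norm (x - y)"
    proof -
      have "\<bar>(r\<^sup>2 - s\<^sup>2) * ?F (?z x)\<bar> \<le> (r\<^sup>2 - s\<^sup>2) * (12 * C / r)"
        unfolding abs_mult using F_z[of x] sq0 by (intro mult_mono) (auto simp: r_def)
      also have "\<dots> = 12 * C * ((r\<^sup>2 - s\<^sup>2) / r)" by simp
      also have "\<dots> \<le> 12 * C * (2 * norm (x - y))"
        using sq d C by (intro mult_left_mono) auto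
      finally show ?thesis by simp
    qed
    \<comment> \<open>Multiplied by \<open>s^2\<close>, the difference of the rescaled lifts is
      \<open>x - y\<close> plus two corrections of size at most \<open>2 * norm (x - y)\<close>,
      thus 5 in all; the radial extension contributes the factor \<open>4 * C\<close>.\<close>
    moreover have "\<bar>s\<^sup>2 * (?F (?z x) - ?F (?z y))\<bar> \<le> 20 * C * norm (x - y)"
    proof -
      have "s\<^sup>2 *\<^sub>R (?z x - ?z y) =
          (x - y) - ((r\<^sup>2 - s\<^sup>2) / r\<^sup>2) *\<^sub>R x + (2 * s * (r - s) / r) *\<^sub>R e"
      proof -
        have "s\<^sup>2 *\<^sub>R (x /\<^sub>R r\<^sup>2) = x - ((r\<^sup>2 - s\<^sup>2) / r\<^sup>2) *\<^sub>R x"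
          using rs by (simp add: diff_divide_distrib algebra_simps divide_inverse)
        moreover have "s\<^sup>2 *\<^sub>R (y /\<^sub>R s\<^sup>2) = y" using rs by simp
        moreover have "s\<^sup>2 *\<^sub>R ((1 - 2 / r) *\<^sub>R e) - s\<^sup>2 *\<^sub>R ((1 - 2 / s) *\<^sub>R e) =
            (2 * s * (r - s) / r) *\<^sub>R e"
        proof -
          have "s\<^sup>2 * (1 - 2 / r) - s\<^sup>2 * (1 - 2 / s) = 2 * s * (r - s) / r"
            using rs by (simp add: field_simps power2_eq_square)
          then show ?thesis by (simp flip: scaleR_diff_left)
        qed
        ultimately show ?thesis
          unfolding r_def[symmetric] s_def[symmetric]
          by (simp only: scaleR_diff_right scaleR_add_right) (simp add: algebra_simps)
      qed
      then have "s\<^sup>2 * norm (?z x - ?z y) \<le> norm (x - y) + norm (((r\<^sup>2 - s\<^sup>2) / r\<^sup>2) *\<^sub>R x) +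
          norm ((2 * s * (r - s) / r) *\<^sub>R e)"
        using norm_triangle_ineq[of "x - y - ((r\<^sup>2 - s\<^sup>2) / r\<^sup>2) *\<^sub>R x" "(2 * s * (r - s) / r) *\<^sub>R e"]
          norm_triangle_ineq4[of "x - y" "((r\<^sup>2 - s\<^sup>2) / r\<^sup>2) *\<^sub>R x"]
          norm_scaleR[of "s\<^sup>2" "?z x - ?z y"]
        by (simp only: abs_of_nonneg[OF zero_le_power2])
      also have "norm (((r\<^sup>2 - s\<^sup>2) / r\<^sup>2) *\<^sub>R x) \<le> 2 * norm (x - y)"
      proof -
        have "norm (((r\<^sup>2 - s\<^sup>2) / r\<^sup>2) *\<^sub>R x) = (r\<^sup>2 - s\<^sup>2) / r\<^sup>2 * norm x" using sq0 by simp
        also have "\<dots> \<le> (r\<^sup>2 - s\<^sup>2) / r\<^sup>2 * r" using sq0 rs by (intro mult_left_mono) auto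
        also have "\<dots> = (r\<^sup>2 - s\<^sup>2) / r" using rs by (simp add: power2_eq_square)
        also note sq
        also have "2 * (r - s) \<le> 2 * norm (x - y)" using d by simp
        finally show ?thesis .
      qed
      also have "norm ((2 * s * (r - s) / r) *\<^sub>R e) \<le> 2 * norm (x - y)"
      proof -
        have "norm ((2 * s * (r - s) / r) *\<^sub>R e) = 2 * s * (r - s) / r" using rs e(1) by simp
        also have "\<dots> = s / r * (2 * (r - s))" by simp
        also have "\<dots> \<le> 1 * (2 * (r - s))" using rs by (intro mult_right_mono) auto
        also have "\<dots> \<le> 2 * norm (x - y)" using d by simp
        finally show ?thesis .
      qed
      finally have "s\<^sup>2 * norm (?z x - ?z y) \<le> 5 * norm (x - y)" by simp
      then have "4 * C * (s\<^sup>2 * norm (?z x - ?z y)) \<le> 4 * C * (5 * norm (x - y))"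
        using C by (intro mult_left_mono) auto
      moreover have "s\<^sup>2 * \<bar>?F (?z x) - ?F (?z y)\<bar> \<le> s\<^sup>2 * (4 * C * norm (?z x - ?z y))"
        using radial_extension_lipschitz[OF f e' e(2), of "?z x" "?z y"] by (intro mult_left_mono) auto
      ultimately show ?thesis by (simp add: abs_mult mult_ac)
    qed
    ultimately show ?thesis by linarith
  qed
  show "\<bar>?F (cone_lift e x) - ?F (cone_lift e y)\<bar> \<le> 44 * C * norm (x - y)"
    using *[of y x] *[of x y] by (cases "norm y \<le> norm x") (auto simp: abs_minus_commute norm_minus_commute)
qed

text \<open>
  With \<open>a = norm x\<close>, the number \<open>\<lambda> = cone_scale a t\<close> is the positive solution of
  \<open>x + t e = \<lambda> \<cdot> cone_lift e (x / \<lambda>)\<close>; it is \<open>0\<close> when \<open>x = 0\<close> and \<open>t \<ge> 0\<close>.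
\<close>

definition cone_scale :: "real \<Rightarrow> real \<Rightarrow> real" where
  "cone_scale a t = (max a (-t))\<^sup>2 / (t + 2 * max a (-t))"

lemma cone_scale_scaleR: "k > 0 \<Longrightarrow> cone_scale (k * a) (k * t) = k * cone_scale a t"
proof -
  assume k: "k > 0"
  have "max (k * a) (- (k * t)) = k * max a (- t)"
    using k by (simp add: max_mult_distrib_left)
  moreover have "k * t + 2 * (k * max a (- t)) = k * (t + 2 * max a (- t))"
    "(k * max a (- t))\<^sup>2 = k * (k * (max a (- t))\<^sup>2)"
    by (simp_all add: distrib_left power2_eq_square)
  ultimately show ?thesis
    using k by (simp only: cone_scale_def) simp
qed

text \<open>\<open>max r (- lift_height r)\<close> recovers \<open>\<rho> = max 1 r\<close>, and
  then numerator and denominator of the scale are both \<open>\<rho>^2\<close>.\<close>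

lemma cone_scale_lift_height: "r \<ge> 0 \<Longrightarrow> cone_scale r (lift_height r) = 1"
proof -
  assume r: "r \<ge> 0"
  have "max r (- lift_height r) = max 1 r"
  proof (cases "r \<le> 1")
    case False
    then have "r * 1 \<le> r * r" by (intro mult_left_mono) auto
    then show ?thesis using False by (simp add: lift_height_def max_def power2_eq_square)
  qed (simp add: lift_height_def max_def)
  moreover have "max 1 r \<noteq> 0" by simp
  ultimately show ?thesis by (simp add: cone_scale_def lift_height_def)
qed

lemma cone_scale_pos:
  assumes "a > 0 \<or> a \<ge> 0 \<and> t < 0"
  shows "cone_scale a t > 0"
  using assms unfolding cone_scale_def by (intro divide_pos_pos) (auto simp: max_def)

lemma lift_height_cone_scale:
  assumes "a > 0 \<or> a \<ge> 0 \<and> t < 0"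
  shows "cone_scale a t * lift_height (a / cone_scale a t) = t"
proof -
  define m where "m = max a (-t)"
  define l where "l = cone_scale a t"
  have l: "l > 0" using cone_scale_pos[OF assms] by (simp add: l_def)
  have m: "m > 0" "t + 2 * m > 0" using assms by (auto simp: m_def max_def)
  have l_eq: "l * (t + 2 * m) = m\<^sup>2" using m by (simp add: l_def cone_scale_def m_def)
  \<comment> \<open>The two maxima switch together: \<open>a \<ge> -t\<close> gives
    \<open>l \<le> a\<close>, and \<open>a < -t\<close> gives \<open>l = -t > a\<close>.\<close>
  have mx: "max 1 (a / l) = m / l"
  proof (cases "a \<ge> -t")
    case True
    then have "m = a" by (simp add: m_def)
    moreover have "l * m \<le> m * m"
    proof -
      have "l * m \<le> l * (t + 2 * m)" using True l \<open>m = a\<close> by (intro mult_left_mono) auto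
      then show ?thesis by (simp add: l_eq power2_eq_square)
    qed
    ultimately show ?thesis using l m by (simp add: max_def field_simps)
  next
    case False
    then have "m = -t" by (simp add: m_def)
    then have "l * m = m * m" using l_eq by (simp add: power2_eq_square)
    then have "l = m" using m by simp
    then have "a / l < 1" using False \<open>m = -t\<close> l by (subst divide_less_eq_1_pos) auto
    then show ?thesis using \<open>l = m\<close> l by simp
  qed
  have "l * lift_height (a / l) = m\<^sup>2 / l - 2 * m"
    unfolding lift_height_def mx using l by (simp add: power2_eq_square right_diff_distrib)
  also have "\<dots> = t" using l by (simp flip: l_eq)
  finally show ?thesis by (simp add: l_def)
qed

text \<open>Controls the weighted term of \<open>homogenization_lipschitz\<close>. The weight is at
  most \<open>3 * \<alpha> / m\<close>, which may blow up as \<open>m\<close> tends to 0, that is,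
  near the direction of \<open>e\<close>; but \<open>\<alpha>\<close> cancels against a denominator
  and the difference of the numerators is itself of order \<open>m\<close>.\<close>

lemma cone_scale_lipschitz:
  fixes a b t s :: real
  defines "m \<equiv> max a (-t)" and "n \<equiv> max b (-s)"
  assumes ab: "a \<ge> 0" "b \<ge> 0" "m > 0" "n \<le> m" "b + \<bar>s\<bar> \<ge> 1"
    and Q: "a \<le> Q" "b \<le> Q" "\<bar>t\<bar> \<le> Q" "\<bar>s\<bar> \<le> Q"
    and d: "\<bar>a - b\<bar> \<le> D" "\<bar>t - s\<bar> \<le> D"
  shows "\<bar>cone_scale a t - cone_scale b s\<bar> * (1 + 2 * a / cone_scale a t) \<le> 30 * Q * D"
proof -
  define \<alpha> where "\<alpha> = t + 2 * m"
  define \<beta> where "\<beta> = s + 2 * n"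
  have \<alpha>: "\<alpha> \<ge> m" by (auto simp: \<alpha>_def m_def)
  \<comment> \<open>For \<open>s \<ge> 0\<close> one has
    \<open>\<beta> \<ge> s + 2 * b \<ge> 1\<close>; for \<open>s < 0\<close>,
    \<open>\<beta> \<ge> n\<close>, and \<open>n\<close> is at least the mean of \<open>b\<close>
    and \<open>-s\<close>.\<close>
  have \<beta>: "\<beta> \<ge> 1 / 2" using ab by (auto simp: \<beta>_def n_def max_def)
  have n: "n \<ge> 0" "n \<le> Q" using ab Q by (auto simp: n_def)
  have m: "m \<le> Q" using Q by (auto simp: m_def)
  have Q0: "Q \<ge> 0" using Q by linarith
  have D0: "D \<ge> 0" using d by linarith
  have mn: "m - n \<le> D" using d by (auto simp: m_def n_def max_def)
  have la: "cone_scale a t = m\<^sup>2 / \<alpha>" "cone_scale b s = n\<^sup>2 / \<beta>"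
    by (simp_all add: cone_scale_def m_def n_def \<alpha>_def \<beta>_def)
  have "1 + 2 * a / (m\<^sup>2 / \<alpha>) \<le> 3 * \<alpha> / m"
  proof -
    have "2 * a / (m\<^sup>2 / \<alpha>) = 2 * a * \<alpha> / m\<^sup>2" by simp
    also have "\<dots> \<le> 2 * m * \<alpha> / m\<^sup>2"
      using \<alpha> ab by (intro divide_right_mono mult_right_mono) (auto simp: m_def)
    also have "\<dots> = 2 * \<alpha> / m" using ab by (simp add: power2_eq_square)
    finally have "2 * a / (m\<^sup>2 / \<alpha>) \<le> 2 * \<alpha> / m" .
    moreover have "1 \<le> \<alpha> / m" using \<alpha> ab by simp
    moreover have "3 * \<alpha> / m = \<alpha> / m + 2 * \<alpha> / m" by (simp add: add_divide_distrib[symmetric])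
    ultimately show ?thesis by linarith
  qed
  then have "\<bar>cone_scale a t - cone_scale b s\<bar> * (1 + 2 * a / cone_scale a t) \<le>
      \<bar>m\<^sup>2 / \<alpha> - n\<^sup>2 / \<beta>\<bar> * (3 * \<alpha> / m)"
    unfolding la by (intro mult_left_mono) auto
  also have "\<bar>m\<^sup>2 / \<alpha> - n\<^sup>2 / \<beta>\<bar> = \<bar>m\<^sup>2 * \<beta> - n\<^sup>2 * \<alpha>\<bar> / (\<alpha> * \<beta>)"
  proof -
    have "m\<^sup>2 / \<alpha> - n\<^sup>2 / \<beta> = (m\<^sup>2 * \<beta> - n\<^sup>2 * \<alpha>) / (\<alpha> * \<beta>)"
      using \<alpha> \<beta> ab by (simp add: diff_frac_eq)
    moreover have "\<alpha> * \<beta> > 0" using \<alpha> \<beta> ab by (intro mult_pos_pos) auto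
    ultimately show ?thesis by simp
  qed
  also have "\<bar>m\<^sup>2 * \<beta> - n\<^sup>2 * \<alpha>\<bar> / (\<alpha> * \<beta>) * (3 * \<alpha> / m) = 3 * \<bar>m\<^sup>2 * \<beta> - n\<^sup>2 * \<alpha>\<bar> / (m * \<beta>)"
    using \<alpha> ab by (simp add: mult_ac)
  also have "\<bar>m\<^sup>2 * \<beta> - n\<^sup>2 * \<alpha>\<bar> \<le> m * (5 * Q * D)"
  proof -
    \<comment> \<open>Arranged so that every summand carries a factor \<open>m\<close>, or
      \<open>m + n\<close>, which is at most \<open>2 * m\<close>; the bounds are
      \<open>1 + 2 + 2 = 5\<close> times \<open>m * Q * D\<close>.\<close>
    have "m\<^sup>2 * \<beta> - n\<^sup>2 * \<alpha> = m * (m * (s - t)) + (m + n) * ((m - n) * t) + m * (2 * n * (m - n))"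
      by (simp add: \<alpha>_def \<beta>_def power2_eq_square algebra_simps)
    moreover have "\<bar>m * (m * (s - t))\<bar> \<le> m * (Q * D)"
      unfolding abs_mult using ab m d Q0 by (intro mult_mono) auto
    moreover have "\<bar>(m + n) * ((m - n) * t)\<bar> \<le> (2 * m) * (D * Q)"
      unfolding abs_mult using ab n mn Q D0 by (intro mult_mono) auto
    moreover have "\<bar>m * (2 * n * (m - n))\<bar> \<le> m * (2 * Q * D)"
      unfolding abs_mult using ab n mn Q0 by (intro mult_mono) auto
    ultimately have "\<bar>m\<^sup>2 * \<beta> - n\<^sup>2 * \<alpha>\<bar> \<le> m * (Q * D) + (2 * m) * (D * Q) + m * (2 * Q * D)"
      by linarith
    then show ?thesis by (simp add: algebra_simps)
  qed
  then have "3 * \<bar>m\<^sup>2 * \<beta> - n\<^sup>2 * \<alpha>\<bar> / (m * \<beta>) \<le> 3 * (m * (5 * Q * D)) / (m * \<beta>)"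
    using ab \<beta> by (intro divide_right_mono mult_left_mono) auto
  also have "\<dots> = 15 * Q * D / \<beta>" using ab by simp
  also have "\<dots> \<le> 15 * Q * D / (1 / 2)"
    using \<beta> Q0 D0 by (intro divide_left_mono) auto
  finally show ?thesis by simp
qed

section \<open>The sphere and the hyperplane with an added point\<close>

text \<open>\<open>A\<close> is the weighted composition with the lift. For its inverse
  \<open>B\<close>, a point \<open>u\<close> of the sphere other than \<open>e\<close> is written as
  \<open>l u\<close> times the lift of \<open>P u / l u\<close>, with \<open>P\<close> the
  projection onto the hyperplane along \<open>e\<close>; the homogeneous extension of
  \<open>f\<close> then takes at \<open>u\<close> the value
  \<open>l u * A f (P u / l u)\<close>.\<close>

lemma isomorphic_lipschitz_free_sphere:
  fixes e :: "'a::real_normed_vector" and h :: "'a \<Rightarrow> real"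
  assumes h: "bounded_linear h" and e: "norm e = 1" "h e = 1"
  shows "isomorphic (lipschitz_free (insert e {x. h x = 0}) e) (lipschitz_free (sphere 0 1) e)"
proof -
  interpret h: bounded_linear h by (rule h)
  let ?H = "{x. h x = 0}"
  obtain K where K: "\<And>x. \<bar>h x\<bar> \<le> norm x * K" "K > 0"
    using h.pos_bounded by auto
  define P where "P u = u - h u *\<^sub>R e" for u
  define l where "l u = cone_scale (norm (P u)) (h u)" for u
  define A where "A = (\<lambda>f x. if x = e then 0 else radial_extension f (cone_lift e x))"
  define B where "B = (\<lambda>g u. l u * g (P u /\<^sub>R l u))"
  have e_sphere: "e \<in> sphere 0 1" using e by simp
  have e_H: "e \<notin> ?H" using e by simp
  have P_H: "P u \<in> ?H" for u by (simp add: P_def h.diff h.scaleR e)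
  have P_scaleR: "P (c *\<^sub>R u) = c *\<^sub>R P u" for c u
    by (simp add: P_def h.scaleR scaleR_diff_right)
  have P_diff: "P (u - v) = P u - P v" for u v
    by (simp add: P_def h.diff algebra_simps)
  have P_norm: "norm (P u) \<le> (1 + K) * norm u" for u
  proof -
    have "norm (P u) \<le> norm u + norm (h u *\<^sub>R e)"
      unfolding P_def by (rule norm_triangle_ineq4)
    then show ?thesis using K(1)[of u] e(1) by (simp add: algebra_simps)
  qed
  have P_lift: "P (cone_lift e x) = x" "h (cone_lift e x) = lift_height (norm x)" if "x \<in> ?H" for x
    using that e(2) by (simp_all add: P_def cone_lift_def h.add h.scaleR)
  have lift_nz: "cone_lift e x \<noteq> 0" if "x \<in> ?H" for x
  proof
    assume 0: "cone_lift e x = 0"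
    then have "x = 0" "lift_height (norm x) = 0"
      using P_lift[OF that] by (simp_all add: P_def h.zero)
    then show False by (simp add: lift_height_def)
  qed
  have l_scaleR: "l (c *\<^sub>R u) = c * l u" if "c > 0" for c u
    using that by (simp add: l_def P_scaleR h.scaleR cone_scale_scaleR)
  have l_lift: "l (cone_lift e x) = 1" if "x \<in> ?H" for x
    using P_lift[OF that] by (simp add: l_def cone_scale_lift_height)
  \<comment> \<open>The scale degenerates at \<open>e\<close>, which makes \<open>B g e = 0\<close>
    for every \<open>g\<close>.\<close>
  have l_e: "l e = 0" by (simp add: l_def P_def e cone_scale_def)
  have A: "lipschitz_operator (sphere 0 1) e (insert e ?H) e A"
  \<comment> \<open>44 serves two points of the hyperplane. Against \<open>e\<close> the linear
    growth bound gives \<open>12 * (1 + 2 * K)\<close>, because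
    \<open>1 = \<bar>h (x - e)\<bar> \<le> K * norm (x - e)\<close>.\<close>
  proof (rule lipschitz_operatorI[where K = "44 + 24 * K"])
    fix x assume "x \<in> insert e ?H"
    then show "finite_combination (sphere 0 1) (\<lambda>f. A f x)"
      using lift_nz[of x] unfolding A_def radial_extension_def
      by (cases "x = e") (auto intro!: finite_combination_intros simp: norm_sgn)
  next
    fix C x y and f :: "'a \<Rightarrow> real"
    assume f: "C-lipschitz_on (sphere 0 1) f" "f e = 0" and xy: "x \<in> insert e ?H" "y \<in> insert e ?H"
    have C: "C \<ge> 0" using f(1) by (rule lipschitz_on_nonneg)
    have HH: "\<bar>A f x - A f y\<bar> \<le> (44 + 24 * K) * C * norm (x - y)" if "x \<in> ?H" "y \<in> ?H" for x y
    proof -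
      have "x \<noteq> e" "y \<noteq> e" using that e_H by auto
      then have "\<bar>A f x - A f y\<bar> \<le> 44 * C * norm (x - y)"
        using radial_extension_cone_lift(2)[OF f(1) e(1) f(2)] by (simp add: A_def)
      also have "\<dots> \<le> (44 + 24 * K) * C * norm (x - y)"
        using C K(2) by (intro mult_right_mono) auto
      finally show ?thesis .
    qed
    have He: "\<bar>A f x\<bar> \<le> (44 + 24 * K) * C * norm (x - e)" if "x \<in> ?H" for x
    proof -
      have "x \<noteq> e" using that e_H by auto
      then have "\<bar>A f x\<bar> \<le> 12 * C * max 1 (norm x)"
        using radial_extension_cone_lift(1)[OF f(1) e(1) f(2)] by (simp add: A_def)
      also have "\<dots> \<le> 12 * C * ((1 + 2 * K) * norm (x - e))"
      proof (intro mult_left_mono)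
        have "norm x \<le> norm (x - e) + 1"
          using norm_triangle_sub[of x e] e(1) by simp
        moreover have "1 \<le> norm (x - e) * K"
          using K(1)[of "x - e"] that e(2) by (simp add: h.diff)
        ultimately show "max 1 (norm x) \<le> (1 + 2 * K) * norm (x - e)"
          using norm_ge_zero[of "x - e"] by (simp add: algebra_simps del: norm_ge_zero)
      qed (use C in simp)
      also have "\<dots> = (12 + 24 * K) * (C * norm (x - e))" by (simp add: algebra_simps)
      also have "\<dots> \<le> (44 + 24 * K) * (C * norm (x - e))"
        using C by (intro mult_right_mono) auto
      finally show ?thesis by (simp add: mult.assoc)
    qed
    have "A f e = 0" by (simp add: A_def)
    then show "\<bar>A f x - A f y\<bar> \<le> (44 + 24 * K) * C * dist x y"
      using xy HH[of x y] He[of x] He[of y] by (auto simp: dist_norm norm_minus_commute)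
  qed (use K(2) in \<open>auto simp: A_def\<close>)
  have B: "lipschitz_operator (insert e ?H) e (sphere 0 1) e B"
  \<comment> \<open>30 comes from \<open>cone_scale_lipschitz\<close> with \<open>Q = 1 + K\<close>
    and \<open>D = (1 + K) * norm (u - v)\<close>, and 1 from the variation of
    \<open>P\<close>.\<close>
  proof (rule lipschitz_operatorI[where K = "31 * (1 + K)\<^sup>2"])
    fix u :: 'a assume "u \<in> sphere 0 1"
    show "finite_combination (insert e ?H) (\<lambda>g. B g u)"
      unfolding B_def using P_H[of u]
      by (intro finite_combination_cmult finite_combination_point) (simp add: h.scaleR)
  next
    fix C and u v :: 'a and g :: "'a \<Rightarrow> real"
    assume g: "C-lipschitz_on (insert e ?H) g" "g e = 0" and uv: "u \<in> sphere 0 1" "v \<in> sphere 0 1"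
    let ?m = "\<lambda>u. max (norm (P u)) (- h u)"
    have C: "C \<ge> 0" using g(1) by (rule lipschitz_on_nonneg)
    have gH: "C-lipschitz_on ?H g" using g(1) by (rule lipschitz_on_subset) auto
    \<comment> \<open>\<open>g\<close> vanishes at \<open>e\<close> and not necessarily at
      \<open>0\<close>, but these points are at distance 1.\<close>
    have g0: "\<bar>g 0\<bar> \<le> C"
      using lipschitz_onD[OF g(1), of 0 e] e(1) g(2) by (simp add: dist_real_def h.zero)
    \<comment> \<open>The estimate of the scale presupposes that the second maximum is the smaller
      one; the other order follows by symmetry.\<close>
    have *: "\<bar>B g u - B g v\<bar> \<le> 31 * (1 + K)\<^sup>2 * C * norm (u - v)"
      if uv: "norm u = 1" "norm v = 1" and mm: "?m v \<le> ?m u" for u v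
    proof (cases "?m u = 0")
      case True
      then have "?m v = 0" using mm norm_ge_zero[of "P v"] by linarith
      then have "B g u = 0" "B g v = 0"
        using True unfolding B_def l_def cone_scale_def by simp_all
      then show ?thesis using C by simp
    next
      case False
      then have mu: "?m u > 0" using norm_ge_zero[of "P u"] by linarith
      then have lu: "l u > 0"
        unfolding l_def by (intro cone_scale_pos) auto
      have lv: "l v \<ge> 0" "l v = 0 \<Longrightarrow> P v = 0"
      proof -
        \<comment> \<open>Either \<open>v\<close> is a nonnegative multiple of \<open>e\<close>,
          where the scale is 0, or the scale is positive.\<close>
        have "P v = 0 \<and> h v \<ge> 0 \<or> norm (P v) > 0 \<or> norm (P v) \<ge> 0 \<and> h v < 0"
          by auto
        then have "P v = 0 \<and> h v \<ge> 0 \<or> l v > 0"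
          unfolding l_def using cone_scale_pos by blast
        moreover have "l v = 0" if "P v = 0" "h v \<ge> 0"
          using that by (simp add: l_def cone_scale_def)
        ultimately show "l v \<ge> 0" "l v = 0 \<Longrightarrow> P v = 0" by auto
      qed
      have "norm v \<le> norm (P v) + norm (h v *\<^sub>R e)"
        using norm_triangle_ineq[of "P v" "h v *\<^sub>R e"] by (simp add: P_def)
      then have sum: "norm (P v) + \<bar>h v\<bar> \<ge> 1" using uv e(1) by simp
      have "\<bar>l u - l v\<bar> * (1 + 2 * norm (P u) / l u) \<le> 30 * (1 + K) * ((1 + K) * norm (u - v))"
        unfolding l_def
      proof (rule cone_scale_lipschitz)
        show "\<bar>norm (P u) - norm (P v)\<bar> \<le> (1 + K) * norm (u - v)"
          using norm_triangle_ineq3[of "P u" "P v"] P_norm[of "u - v"] by (simp add: P_diff)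
        show "\<bar>h u - h v\<bar> \<le> (1 + K) * norm (u - v)"
        proof -
          have "norm (u - v) * K \<le> (1 + K) * norm (u - v)" by (simp add: algebra_simps)
          then show ?thesis using K(1)[of "u - v"] by (simp add: h.diff)
        qed
      qed (use mu mm sum P_norm[of u] P_norm[of v] K(1)[of u] K(1)[of v] uv in auto)
      moreover have "norm (P u - P v) \<le> (1 + K)\<^sup>2 * norm (u - v)"
      proof -
        have "(1 + K) * norm (u - v) \<le> (1 + K)\<^sup>2 * norm (u - v)"
          using K(2) by (intro mult_right_mono) (auto simp: power2_eq_square)
        then show ?thesis using P_norm[of "u - v"] by (simp add: P_diff)
      qed
      ultimately have le: "norm (P u - P v) + \<bar>l u - l v\<bar> * (1 + 2 * norm (P u) / l u) \<le>
          31 * (1 + K)\<^sup>2 * norm (u - v)"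
        by (simp add: power2_eq_square algebra_simps)
      have "\<bar>B g u - B g v\<bar> \<le>
          C * (norm (P u - P v) + \<bar>l u - l v\<bar> * (1 + 2 * norm (P u) / l u))"
        unfolding B_def
        by (rule homogenization_lipschitz[OF gH g0 _ _ P_H P_H lu lv]) (auto simp: h.zero h.scaleR)
      also have "\<dots> \<le> C * (31 * (1 + K)\<^sup>2 * norm (u - v))"
        using le C by (intro mult_left_mono)
      finally show ?thesis by (simp add: mult_ac)
    qed
    have uv': "norm u = 1" "norm v = 1" using uv by auto
    show "\<bar>B g u - B g v\<bar> \<le> 31 * (1 + K)\<^sup>2 * C * dist u v"
      unfolding dist_norm
    proof (cases rule: linorder_le_cases[of "?m v" "?m u"])
      case le
      then show "\<bar>B g u - B g v\<bar> \<le> 31 * (1 + K)\<^sup>2 * C * norm (u - v)"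
        using *[OF uv'] by blast
    next
      case ge
      then show "\<bar>B g u - B g v\<bar> \<le> 31 * (1 + K)\<^sup>2 * C * norm (u - v)"
        using *[OF uv'(2,1)] by (subst abs_minus_commute, subst norm_minus_commute) blast
    qed
  qed (auto simp: B_def l_e)
  show ?thesis
  proof (rule lipschitz_free_isomorphicI[OF A B])
    show "A (B g) x = g x" if x: "x \<in> insert e ?H" "g e = 0" for g x
    proof (cases "x = e")
      case True
      then show ?thesis using that by (simp add: A_def)
    next
      case False
      let ?w = "cone_lift e x"
      have xH: "x \<in> ?H" using x False by simp
      have w: "norm ?w > 0" using lift_nz[OF xH] by simp
      \<comment> \<open>Normalizing the lift divides its scale 1 and its projection \<open>x\<close>
        by the same number, so their quotient is still \<open>x\<close>.\<close>
      have "l (sgn ?w) = inverse (norm ?w)" "P (sgn ?w) = x /\<^sub>R norm ?w"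
        using l_scaleR[of "inverse (norm ?w)" ?w] w l_lift[OF xH] P_lift[OF xH]
        by (simp_all add: sgn_div_norm P_scaleR)
      then have "B g (sgn ?w) = inverse (norm ?w) * g x"
        using w by (simp add: B_def)
      then show ?thesis using False w by (simp add: A_def radial_extension_def)
    qed
    show "B (A f) u = f u" if u: "u \<in> sphere 0 1" "f e = 0" for f u
    proof (cases "P u = 0 \<and> h u \<ge> 0")
      case True
      \<comment> \<open>On the sphere this case is the single point \<open>u = e\<close>.\<close>
      then have "u = h u *\<^sub>R e" by (simp add: P_def)
      then have "norm u = \<bar>h u\<bar>" using e(1) by (metis norm_scaleR mult.right_neutral)
      then have "u = e" using \<open>u = h u *\<^sub>R e\<close> u(1) True by simp
      then show ?thesis using u(2) by (simp add: B_def l_e)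
    next
      case False
      then have pos: "norm (P u) > 0 \<or> norm (P u) \<ge> 0 \<and> h u < 0" by auto
      let ?x = "P u /\<^sub>R l u"
      have lu: "l u > 0" unfolding l_def using pos by (rule cone_scale_pos)
      have "l u * lift_height (norm (P u) / l u) = h u"
        unfolding l_def using pos by (rule lift_height_cone_scale)
      then have "l u *\<^sub>R cone_lift e ?x = P u + h u *\<^sub>R e"
        using lu by (simp add: cone_lift_def scaleR_add_right divide_inverse mult.commute)
      also have "\<dots> = u" by (simp add: P_def)
      finally have lift: "cone_lift e ?x = inverse (l u) *\<^sub>R u"
        using lu by (metis less_irrefl scaleR_left_imp_eq scaleR_scaleR right_inverse scaleR_one)
      have "?x \<noteq> e" using P_H[of u] e(2) by (metis (mono_tags) h.scaleR mem_Collect_eq scaleR_zero_right zero_neq_one)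
      moreover have "radial_extension f u = f u"
        using u(1) by (simp add: radial_extension_def sgn_div_norm)
      ultimately show ?thesis
        using lu by (simp add: B_def A_def lift radial_extension_scaleR)
    qed
  qed (use e_sphere in auto)
qed

section \<open>The chain of isomorphisms from the whole space to the sphere\<close>

theorem mainTheorem1:
  fixes s :: "'a::banach"
  assumes "\<exists>H::'a set. closed_hyperplane H \<and>
             isomorphic (subspace_of_type (UNIV::'a set)) (subspace_of_type H)"
    and "s \<in> sphere 0 1"
  shows "isomorphic (lipschitz_free (UNIV::'a set) 0) (lipschitz_free (sphere (0::'a) 1) s)"
proof -
  obtain H :: "'a set" and h0 :: "'a \<Rightarrow> real" and x0 where h0: "bounded_linear h0" "h0 x0 \<noteq> 0"
    and H: "H = {x. h0 x = 0}" and iso: "isomorphic (subspace_of_type (UNIV::'a set)) (subspace_of_type H)"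
    using assms(1) unfolding closed_hyperplane_def by blast
  interpret h0: bounded_linear h0 by (rule h0)
  \<comment> \<open>A unit vector off the hyperplane; dividing \<open>h0\<close> by
    \<open>h0 e\<close> keeps the kernel and gives \<open>h e = 1\<close>.\<close>
  define e where "e = sgn x0"
  define h where "h x = h0 x / h0 e" for x
  have "x0 \<noteq> 0" using h0(2) h0.zero by auto
  then have e: "norm e = 1" "h0 e \<noteq> 0"
    using h0(2) by (auto simp: e_def norm_sgn sgn_div_norm h0.scaleR)
  have h: "bounded_linear h" "h e = 1"
    using bounded_linear_compose[OF bounded_linear_divide h0(1)] e
    by (auto simp: h_def[abs_def])
  have H_h: "H = {x. h x = 0}" using e by (auto simp: H h_def)
  obtain T U where T: "bounded_linear_map (subspace_of_type (UNIV::'a set)) (subspace_of_type H) T"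
    and U: "bounded_linear_map (subspace_of_type H) (subspace_of_type UNIV) U"
    and "\<And>x. x \<in> vecs (subspace_of_type UNIV) \<Longrightarrow> U (T x) = x"
    and "\<And>y. y \<in> vecs (subspace_of_type H) \<Longrightarrow> T (U y) = y"
    using isomorphicE[OF iso] by metis
  then have UT: "U (T x) = x" and TU: "y \<in> H \<Longrightarrow> T (U y) = y" for x y
    by (simp_all add: subspace_of_type_def)
  \<comment> \<open>Additivity is known on the carrier only, so differences have to stay in
    \<open>V\<close>.\<close>
  have lipschitz: "\<exists>K. K-lipschitz_on V S"
    if S: "bounded_linear_map (subspace_of_type V) (subspace_of_type W) S" and V: "subspace V"
    for V W :: "'a set" and S
  proof -
    obtain K where K: "K \<ge> 0" "\<And>x. x \<in> V \<Longrightarrow> norm (S x) \<le> K * norm x"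
      using bounded_linear_map_bound[OF S] unfolding subspace_of_type_def by auto
    have "\<forall>x\<in>V. \<forall>y\<in>V. S (x + y) = S x + S y"
      using S by (simp add: bounded_linear_map_def subspace_of_type_def)
    then have add: "S (x - y + y) = S (x - y) + S y" if "x \<in> V" "y \<in> V" for x y
      using subspace_diff[OF V that] that(2) by blast
    have "norm (S x - S y) \<le> K * norm (x - y)" if "x \<in> V" "y \<in> V" for x y
      using add[OF that] K(2)[OF subspace_diff[OF V that]] by simp
    then have "K-lipschitz_on V S"
      using K(1) by (intro lipschitz_onI) (auto simp: dist_norm)
    then show ?thesis by blast
  qed
  have "subspace H"
    unfolding H by (intro subspaceI) (auto simp: h0.zero h0.add h0.scaleR)
  obtain K where K: "K-lipschitz_on UNIV T" using lipschitz[OF T] by auto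
  obtain L where L: "L-lipschitz_on H U" using lipschitz[OF U \<open>subspace H\<close>] by auto
  have T_H: "T x \<in> H" for x
    using T by (simp add: bounded_linear_map_def subspace_of_type_def)
  have T_zero: "T 0 = 0"
  proof -
    have "\<forall>c x. T (c *\<^sub>R x) = c *\<^sub>R T x"
      using T by (simp add: bounded_linear_map_def subspace_of_type_def)
    then have "T (0 *\<^sub>R 0) = 0 *\<^sub>R T 0" by blast
    then show ?thesis by simp
  qed
  \<comment> \<open>The injective \<open>T\<close> carries a nonzero vector into \<open>H\<close>;
    this provides the direction \<open>v\<close> of the ray used for the shift.\<close>
  have "T e \<noteq> 0"
    using UT[of e] UT[of 0] T_zero e(1) by (metis norm_zero zero_neq_one)
  define v where "v = sgn (T e)"
  have v: "norm v = 1" "real n *\<^sub>R v \<in> H" for n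
    using \<open>T e \<noteq> 0\<close> T_H[of e] \<open>subspace H\<close> by (auto simp: v_def norm_sgn sgn_div_norm subspace_scale)
  have 1: "isomorphic (lipschitz_free (UNIV::'a set) 0) (lipschitz_free H 0)"
    using isomorphic_lipschitz_free_bilipschitz[OF K _ L _ UT TU, of 0] T_H T_zero by auto
  interpret h: bounded_linear h by (rule h)
  obtain B where B: "\<And>x. \<bar>h x\<bar> \<le> norm x * B"
    using h.bounded by auto
  \<comment> \<open>\<open>e\<close> keeps a positive distance from \<open>H\<close>, since
    \<open>h (x - e) = -1\<close> there.\<close>
  have "1 \<le> B * norm (x - e)" if "x \<in> H" for x
    using B[of "x - e"] that h(2) by (simp add: H_h h.diff mult.commute)
  then have "isomorphic (lipschitz_free (insert e H) e) (lipschitz_free H 0)"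
    using v e h(2) by (intro isomorphic_lipschitz_free_insert[where K = B and v = v]) (auto simp: H_h)
  then have 2: "isomorphic (lipschitz_free H 0) (lipschitz_free (insert e H) e)"
    by (rule isomorphic_sym) (simp add: normed_subspace_lipschitz_free)
  have 3: "isomorphic (lipschitz_free (insert e H) e) (lipschitz_free (sphere 0 1) e)"
    unfolding H_h using h(1) e(1) h(2) by (rule isomorphic_lipschitz_free_sphere)
  have 4: "isomorphic (lipschitz_free (sphere 0 1) e) (lipschitz_free (sphere (0::'a) 1) s)"
    using e(1) assms(2) by (intro isomorphic_lipschitz_free_base_point) auto
  have mem: "0 \<in> H" "e \<in> sphere 0 1" using \<open>subspace H\<close> e(1) by (auto simp: subspace_0)
  note trans = lipschitz_free_isomorphic_trans
  from 2 3 have "isomorphic (lipschitz_free H 0) (lipschitz_free (sphere 0 1) e)"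
    by (rule trans) (use mem in auto)
  from this 4 have "isomorphic (lipschitz_free H 0) (lipschitz_free (sphere 0 1) s)"
    by (rule trans) (use mem assms(2) in auto)
  with 1 show ?thesis
    by (rule trans) (use mem assms(2) in auto)
qed

end
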